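(* Let $\mathbb{F}$ be a finite field. For every $k,m,r\in\mathbb{N}$ there is $n$ such that for every $c:M^k_{n,n}(\mathbb{F})\to r$ there are $R_0,R_1\in\mathcal{E}_{n,m}(\mathbb{F})$ such that $\tau^{(2)}$ is a factor of $c$ on $R_0\cdot M^k_{m,m}(\mathbb{F})\cdot R_1^{\mathrm{t}}$, i.e. the color $c(R_0\cdot A\cdot R_1^{\mathrm{t}})$ depends only on $\tau^{(2)}(A)$ for $A\in M^k_{m,m}(\mathbb{F})$.
   Context: $r$ is identified with $\{0,\dots,r-1\}$. $M^k_{n,m}(\mathbb{F})$ is the set of $n\times m$ matrices over $\mathbb{F}$ of rank $k$. With $(u_i)$ the unit basis, a $p\times q$ matrix $A$ is in RREF if there are $p_0\le p$ and $j_0<\dots<j_{p_0-1}<q$ with $Au_{j_i}=u_i$ and $\langle Au_j\rangle_{j<j_i}=\langle u_l\rangle_{l<i}$ for $i<p_0$; it is in RCEF if its transpose is in RREF. $\mathcal{E}_{n,k}(\mathbb{F})$ is the set of $n\times k$ matrices of rank $k$ in RCEF. $\tau^{(2)}:M^k_{n,n}(\mathbb{F})\to\mathrm{GL}(\mathbb{F}^k)$ is the map uniquely determined by $A=A_0\cdot\tau^{(2)}(A)\cdot A_1^{\mathrm{t}}$ for some $A_0,A_1\in\mathcal{E}_{n,k}(\mathbb{F})$.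
   Formalization: In the definition of RREF the span condition is also required for i = p_0 with j_{p_0} = q (rows after the last pivot vanish); without it p_0 = 0 would make every matrix RREF and τ^(2) would not be uniquely determined. *)

theory Defs
  imports "Jordan_Normal_Form.DL_Rank"
begin

definition mrank :: "'a::field mat \<Rightarrow> nat" where
  "mrank A = vec_space.rank (dim_row A) A"

text \<open>Reduced row echelon form, as in the paper, with the convention j_{p0} = q
(i.e. the span condition is also required for i = p0, with all columns).\<close>

definition vspan :: "nat \<Rightarrow> 'a::field vec set \<Rightarrow> 'a vec set" where
  "vspan p S = LinearCombinations.module.span class_ring (module_vec TYPE('a) p) S"

definition RREF :: "'a::field mat \<Rightarrow> bool" where
  "RREF A \<longleftrightarrow> (\<exists>p0 \<le> dim_row A. \<exists>j :: nat \<Rightarrow> nat.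
     (\<forall>i i'. i < i' \<and> i' < p0 \<longrightarrow> j i < j i') \<and>
     (\<forall>i < p0. j i < dim_col A) \<and>
     (\<forall>i < p0. col A (j i) = unit_vec (dim_row A) i) \<and>
     (\<forall>i \<le> p0. vspan (dim_row A)
                   (col A ` {..< (if i = p0 then dim_col A else j i)})
              = vspan (dim_row A) (unit_vec (dim_row A) ` {..< i})))"

definition RCEF :: "'a::field mat \<Rightarrow> bool" where
  "RCEF A \<longleftrightarrow> RREF (transpose_mat A)"

definition Mk :: "nat \<Rightarrow> nat \<Rightarrow> nat \<Rightarrow> 'a::field mat set" where
  "Mk k n m = {A \<in> carrier_mat n m. mrank A = k}"

definition Ech :: "nat \<Rightarrow> nat \<Rightarrow> 'a::field mat set" where
  "Ech n k = {A \<in> carrier_mat n k. mrank A = k \<and> RCEF A}"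

definition tau2 :: "'a::field mat \<Rightarrow> 'a mat" where
  "tau2 A = (THE T. T \<in> carrier_mat (mrank A) (mrank A) \<and> invertible_mat T \<and>
     (\<exists>A0 \<in> Ech (dim_row A) (mrank A). \<exists>A1 \<in> Ech (dim_row A) (mrank A).
        A = A0 * T * transpose_mat A1))"

end

(* Every A of rank k is A0 T A1^t with A0, A1 echelon of rank k and T = tau2 A unique, and
   R0 A R1^t = (R0 A0) T (R1 A1)^t. So the theorem is a product Ramsey statement for pairs of
   echelon matrices, where the finitely many T are absorbed into the colour, and it follows from
   two applications of the Graham-Leeb-Rothschild theorem in the form: for every colouring of the
   n x k echelon matrices some R makes R * (m x k echelon matrices) monochromatic.
   The latter goes by induction on the number of columns. First, the rows below the last pivot
   are made irrelevant. They lie in the span of the rows above, so relative to those rows they are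
   words of coefficient vectors, and the Hales-Jewett theorem applies to these words. Then, by
   the induction hypothesis applied to the part above the last pivot, the colour is made to depend
   only on the position of that pivot, and the pigeonhole principle removes this dependence. *)
theory Submission
  imports Defs "HOL-Library.FuncSet" "HOL-Library.Infinite_Set"
begin

text \<open>An echelon matrix of full column rank is the canonical basis matrix of its column space.
  Products of echelon matrices are again echelon, with pivot positions composed, so left
  multiplication by \<open>R\<close> restricts a colouring to subspaces of the column space of
  \<open>R\<close>, and successive restrictions are products. The difficulty is that a later
  restriction must not undo what an earlier one achieved. Two facts provide for this. The
  restriction made for last pivot position i leaves the rows 0, ..., i unchanged, so it can follow
  the restrictions for smaller positions. And the row of pivot t, like every row above it, is
  supported on the columns up to t, so independence of the rows below the last pivot survives every
  further restriction.\<close>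

section \<open>Finite families of colourings\<close>

text \<open>\<open>r'\<close> counts the functions from \<open>U\<close> to r colours. It is chosen
  before \<open>F\<close> and \<open>X\<close>, so that a Ramsey number for \<open>r'\<close>
  colours can be fixed before the colouring is given.\<close>

lemma encode_colour_family:
  assumes U: "finite U"
  shows "\<exists>r'. \<forall>(F :: 'x \<Rightarrow> 'u \<Rightarrow> nat) X. (\<forall>x\<in>X. \<forall>u\<in>U. F x u < r) \<longrightarrow>
    (\<exists>c. (\<forall>x\<in>X. c x < (r'::nat)) \<and>
         (\<forall>x\<in>X. \<forall>y\<in>X. c x = c y \<longrightarrow> (\<forall>u\<in>U. F x u = F y u)))"
proof -
  define D where "D = PiE U (\<lambda>_. {..<r})"
  have "finite D" unfolding D_def using U by (intro finite_PiE) auto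
  then obtain h where h: "bij_betw h D {..<card D}"
    using ex_bij_betw_finite_nat by (metis atLeast0LessThan)
  show ?thesis
  proof (intro exI[of _ "card D"] allI impI)
    fix F :: "'x \<Rightarrow> 'u \<Rightarrow> nat" and X assume F: "\<forall>x\<in>X. \<forall>u\<in>U. F x u < r"
    have m: "restrict (F x) U \<in> D" if "x \<in> X" for x
      using that F unfolding D_def by auto
    show "\<exists>c. (\<forall>x\<in>X. c x < card D) \<and>
         (\<forall>x\<in>X. \<forall>y\<in>X. c x = c y \<longrightarrow> (\<forall>u\<in>U. F x u = F y u))"
    proof (intro exI[of _ "\<lambda>x. h (restrict (F x) U)"] conjI ballI impI)
      show "h (restrict (F x) U) < card D" if "x \<in> X" for x
        using bij_betwE[OF h] m[OF that] by auto
      fix x y u assume *: "x \<in> X" "y \<in> X" "h (restrict (F x) U) = h (restrict (F y) U)" "u \<in> U"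
      then have "restrict (F x) U = restrict (F y) U"
        using inj_onD[OF bij_betw_imp_inj_on[OF h]] m by blast
      then show "F x u = F y u" using \<open>u \<in> U\<close> by (metis restrict_apply')
    qed
  qed
qed

lemma finite_carrier_mat: "finite (carrier_mat n m :: 'a::finite mat set)"
proof -
  define D where "D = PiE ({..<n} \<times> {..<m}) (\<lambda>_. UNIV :: 'a set)"
  have "finite D" unfolding D_def by (intro finite_PiE) auto
  moreover have "carrier_mat n m \<subseteq> mat n m ` D"
  proof
    fix A :: "'a mat" assume A: "A \<in> carrier_mat n m"
    let ?f = "restrict (\<lambda>ij. A $$ ij) ({..<n} \<times> {..<m})"
    have "A = mat n m ?f" using A by (intro eq_matI) auto
    moreover have "?f \<in> D" unfolding D_def by auto
    ultimately show "A \<in> mat n m ` D" by blast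
  qed
  ultimately show ?thesis by (meson finite_imageI finite_subset)
qed

section \<open>The Hales--Jewett theorem\<close>

definition words :: "'a set \<Rightarrow> nat \<Rightarrow> 'a list set" where
  "words A n = {w. set w \<subseteq> A \<and> length w = n}"

text \<open>A combinatorial line is a word over \<open>'a option\<close>, where \<open>None\<close> is the variable.\<close>

definition lines :: "'a set \<Rightarrow> nat \<Rightarrow> 'a option list set" where
  "lines A n = {t. set t \<subseteq> insert None (Some ` A) \<and> length t = n \<and> None \<in> set t}"

definition point :: "'a \<Rightarrow> 'a option list \<Rightarrow> 'a list" where
  "point a t = map (case_option a id) t"

lemma point_append [simp]: "point a (s @ t) = point a s @ point a t"
  by (simp add: point_def)

lemma point_map_Some [simp]: "point a (map Some w) = w"
  by (induction w) (auto simp: point_def)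

lemma words_append: "u \<in> words A m \<Longrightarrow> v \<in> words A n \<Longrightarrow> u @ v \<in> words A (m + n)"
  by (auto simp: words_def)

lemma finite_words: "finite A \<Longrightarrow> finite (words A n)"
  unfolding words_def by (rule finite_lists_length_eq)

lemma point_in_words: "t \<in> lines A n \<Longrightarrow> a \<in> A \<Longrightarrow> point a t \<in> words A n"
  by (auto simp: lines_def words_def point_def split: option.split)

lemma lines_mono: "A \<subseteq> B \<Longrightarrow> lines A n \<subseteq> lines B n"
  by (auto simp: lines_def)

lemma lines_append: "s \<in> lines A m \<Longrightarrow> t \<in> lines A n \<Longrightarrow> s @ t \<in> lines A (m + n)"
  by (auto simp: lines_def)

lemma lines_append_const: "s \<in> lines A m \<Longrightarrow> w \<in> words A n \<Longrightarrow> s @ map Some w \<in> lines A (m + n)"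
  by (auto simp: lines_def words_def)

lemma lines_const_append: "w \<in> words A m \<Longrightarrow> t \<in> lines A n \<Longrightarrow> map Some w @ t \<in> lines A (m + n)"
  by (auto simp: lines_def words_def)

definition mono_line :: "('a list \<Rightarrow> nat) \<Rightarrow> 'a set \<Rightarrow> 'a option list \<Rightarrow> bool" where
  "mono_line c A t \<longleftrightarrow> (\<forall>a\<in>A. \<forall>b\<in>A. c (point a t) = c (point b t))"

definition HJ_for :: "'a set \<Rightarrow> nat \<Rightarrow> nat \<Rightarrow> bool" where
  "HJ_for A r N \<longleftrightarrow> (\<forall>c. (\<forall>w\<in>words A N. c w < r) \<longrightarrow> (\<exists>t\<in>lines A N. mono_line c A t))"

text \<open>Colour focusing: \<open>s\<close> lines that meet in one point \<open>f\<close> at the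
  letter \<open>x\<close>, each of one colour on the letters of \<open>A\<close>, with pairwise
  distinct colours. The colours are collected in \<open>V\<close>, so its cardinality counts the
  lines.\<close>

definition focused :: "('a list \<Rightarrow> nat) \<Rightarrow> 'a set \<Rightarrow> 'a \<Rightarrow> nat \<Rightarrow> nat \<Rightarrow> bool" where
  "focused c A x N s \<longleftrightarrow> (\<exists>f\<in>words (insert x A) N. \<exists>V. finite V \<and> card V = s \<and>
     (\<forall>v\<in>V. \<exists>t\<in>lines (insert x A) N. point x t = f \<and> (\<forall>a\<in>A. c (point a t) = v)))"

text \<open>Words are split into a prefix of length \<open>N'\<close> and a suffix of length
  \<open>N\<close>. Colouring a prefix by the whole function that it induces on suffixes, the
  theorem for the smaller alphabet \<open>A\<close> gives a line \<open>t\<close> of prefixes on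
  which this function is the same at all letters of \<open>A\<close>. The assumption on
  \<open>N\<close> then applies to this common function.\<close>

lemma focusing_step:
  fixes A :: "'a set"
  assumes A: "finite A" "a0 \<in> A"
    and HJ: "\<And>r. \<exists>N. HJ_for A r N"
    and N: "\<forall>c. (\<forall>w\<in>words (insert x A) N. c w < r) \<longrightarrow>
       (\<exists>t\<in>lines (insert x A) N. mono_line c (insert x A) t) \<or> focused c A x N s"
  shows "\<exists>N. \<forall>c. (\<forall>w\<in>words (insert x A) N. c w < r) \<longrightarrow>
       (\<exists>t\<in>lines (insert x A) N. mono_line c (insert x A) t) \<or> focused c A x N (Suc s)"
proof -
  let ?B = "insert x A"
  have fin: "finite (words ?B N)" using A by (simp add: finite_words)
  obtain r' where r':
    "\<forall>(F :: 'a list \<Rightarrow> 'a list \<Rightarrow> nat) X. (\<forall>x\<in>X. \<forall>u\<in>words ?B N. F x u < r) \<longrightarrow>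
      (\<exists>c. (\<forall>x\<in>X. c x < (r'::nat)) \<and>
         (\<forall>x\<in>X. \<forall>y\<in>X. c x = c y \<longrightarrow> (\<forall>u\<in>words ?B N. F x u = F y u)))"
    using encode_colour_family[where r = r and ?'x = "'a list", OF fin] by (rule exE)
  obtain N' where N': "HJ_for A r' N'" using HJ by blast
  show ?thesis
  proof (intro exI[of _ "N' + N"] allI impI)
    fix c :: "'a list \<Rightarrow> nat" assume c: "\<forall>w\<in>words ?B (N' + N). c w < r"
    have "\<forall>w\<in>words A N'. \<forall>u\<in>words ?B N. c (w @ u) < r"
    proof (intro ballI)
      fix w u assume "w \<in> words A N'" "u \<in> words ?B N"
      then have "w @ u \<in> words ?B (N' + N)" by (auto simp: words_def)
      then show "c (w @ u) < r" using c by blast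
    qed
    from r'[THEN spec[of _ "\<lambda>w u. c (w @ u)"], THEN spec[of _ "words A N'"], THEN mp, OF this]
    obtain d where d: "\<forall>w\<in>words A N'. d w < r'"
      "\<forall>w\<in>words A N'. \<forall>w'\<in>words A N'. d w = d w' \<longrightarrow> (\<forall>u\<in>words ?B N. c (w @ u) = c (w' @ u))"
      by (elim exE conjE)
    obtain t where t: "t \<in> lines A N'" "mono_line d A t"
      using N'[unfolded HJ_for_def, rule_format, of d] d(1) by auto
    have tB: "t \<in> lines ?B N'" using t(1) lines_mono[of A ?B N'] by (metis subsetD subset_insertI)
    have eq: "c (point a t @ u) = c (point a0 t @ u)" if "a \<in> A" "u \<in> words ?B N" for a u
    proof -
      have "d (point a t) = d (point a0 t)" using t(2) that(1) A(2) unfolding mono_line_def by blast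
      with d(2) point_in_words[OF t(1) that(1)] point_in_words[OF t(1) A(2)]
      have "\<forall>u\<in>words ?B N. c (point a t @ u) = c (point a0 t @ u)" by (metis (no_types, lifting))
      then show ?thesis using that(2) by blast
    qed
    have pB: "point a0 t \<in> words ?B N'" using point_in_words[OF tB] A by blast
    \<comment> \<open>By \<open>eq\<close>, any other letter of \<open>A\<close> in place of
      \<open>a0\<close> induces the same colouring of suffixes.\<close>
    define c' where "c' = (\<lambda>u. c (point a0 t @ u))"
    have "\<forall>u\<in>words ?B N. c' u < r"
      using c words_append[OF pB] unfolding c'_def by blast
    with N have "(\<exists>t\<in>lines ?B N. mono_line c' ?B t) \<or> focused c' A x N s" by blast
    then show "(\<exists>t\<in>lines ?B (N' + N). mono_line c ?B t) \<or> focused c A x (N' + N) (Suc s)"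
    proof
      assume "\<exists>t\<in>lines ?B N. mono_line c' ?B t"
      then obtain l where l: "l \<in> lines ?B N" "mono_line c' ?B l" by blast
      have "map Some (point a0 t) @ l \<in> lines ?B (N' + N)"
        using lines_const_append[OF pB l(1)] .
      moreover have "mono_line c ?B (map Some (point a0 t) @ l)"
        using l(2) unfolding mono_line_def c'_def point_append point_map_Some .
      ultimately show ?thesis by blast
    next
      assume "focused c' A x N s"
      then obtain f V where f: "f \<in> words ?B N" and V: "finite V" "card V = s"
        and l: "\<forall>v\<in>V. \<exists>l\<in>lines ?B N. point x l = f \<and> (\<forall>a\<in>A. c' (point a l) = v)"
        unfolding focused_def by (elim bexE exE conjE)
      show ?thesis
      \<comment> \<open>If the focus has a colour from \<open>V\<close>, the line of that colour
        stays monochromatic when \<open>x\<close> is added. Otherwise the colour of the focus is a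
        new one.\<close>
      proof (cases "c' f \<in> V")
        case True
        then obtain l0 where l0: "l0 \<in> lines ?B N" "point x l0 = f"
          "\<forall>a\<in>A. c' (point a l0) = c' f" using l by blast
        have "map Some (point a0 t) @ l0 \<in> lines ?B (N' + N)"
          using lines_const_append[OF pB l0(1)] .
        moreover have "mono_line c ?B (map Some (point a0 t) @ l0)"
        proof -
          have "c' (point a l0) = c' f" if "a \<in> ?B" for a using that l0(2,3) by blast
          then show ?thesis unfolding mono_line_def c'_def point_append point_map_Some by metis
        qed
        ultimately show ?thesis by blast
      next
        case False
        have "point x t \<in> words ?B N'" using point_in_words[OF tB] by blast
        then have f': "point x t @ f \<in> words ?B (N' + N)" using words_append f by blast
        \<comment> \<open>For an old colour, prefix and suffix move together along
          \<open>t @ l0\<close>; for the new colour only the prefix moves while the suffix rests at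
          \<open>f\<close>. At \<open>x\<close> all these lines pass through the new focus
          \<open>point x t @ f\<close>.\<close>
        have "\<exists>l\<in>lines ?B (N' + N). point x l = point x t @ f \<and> (\<forall>a\<in>A. c (point a l) = v)"
          if "v \<in> insert (c' f) V" for v
        proof (cases "v \<in> V")
          case True
          then obtain l0 where l0: "l0 \<in> lines ?B N" "point x l0 = f"
            "\<forall>a\<in>A. c' (point a l0) = v" using l by blast
          have "\<forall>a\<in>A. c (point a (t @ l0)) = v"
          proof
            fix a assume a: "a \<in> A"
            then have "point a l0 \<in> words ?B N" using point_in_words[OF l0(1)] by blast
            from eq[OF a this] show "c (point a (t @ l0)) = v"
              using l0(3) a unfolding c'_def by simp
          qed
          with lines_append[OF tB l0(1)] l0(2) show ?thesis
            by (intro bexI[of _ "t @ l0"]) auto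
        next
          case False
          with that have v: "v = c' f" by blast
          have "\<forall>a\<in>A. c (point a (t @ map Some f)) = v"
            unfolding point_append point_map_Some v c'_def using eq[OF _ f] by blast
          with lines_append_const[OF tB f] show ?thesis
            by (intro bexI[of _ "t @ map Some f"]) auto
        qed
        moreover have "finite (insert (c' f) V)" "card (insert (c' f) V) = Suc s"
          using V False by auto
        ultimately show ?thesis unfolding focused_def using f' by blast
      qed
    qed
  qed
qed

theorem hales_jewett:
  assumes "finite (A :: 'a set)"
  shows "\<exists>N. HJ_for A r N"
  using assms
proof (induction A arbitrary: r rule: finite_induct)
  case empty
  show ?case by (intro exI[of _ 1]) (auto simp: HJ_for_def mono_line_def lines_def
      intro!: exI[of _ "[None]"])
next
  case (insert x A)
  show ?case
  \<comment> \<open>The focusing step needs a reference letter in \<open>A\<close>. Over a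
    one-letter alphabet every line is monochromatic.\<close>
  proof (cases "A = {}")
    case True
    show ?thesis by (intro exI[of _ 1]) (auto simp: True HJ_for_def mono_line_def lines_def
      intro!: exI[of _ "[None]"])
  next
    case False
    then obtain a0 where a0: "a0 \<in> A" by blast
    let ?B = "insert x A"
    have foc: "\<exists>N. \<forall>c. (\<forall>w\<in>words ?B N. c w < r) \<longrightarrow>
       (\<exists>t\<in>lines ?B N. mono_line c ?B t) \<or> focused c A x N s" for s
    proof (induction s)
      case 0
      have "focused c A x 0 0" for c
        unfolding focused_def by (auto simp: words_def intro!: exI[of _ "{}"])
      then show ?case by blast
    next
      case (Suc s)
      then show ?case by (elim exE) (rule focusing_step[OF insert.hyps(1) a0 insert.IH])
    qed
    \<comment> \<open>With only r colours, \<open>Suc r\<close> lines of distinct colours cannot be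
      focused, so the other alternative holds.\<close>
    obtain N where N: "\<forall>c. (\<forall>w\<in>words ?B N. c w < r) \<longrightarrow>
       (\<exists>t\<in>lines ?B N. mono_line c ?B t) \<or> focused c A x N (Suc r)"
      using foc[of "Suc r"] by (rule exE)
    have "\<not> focused c A x N (Suc r)" if c: "\<forall>w\<in>words ?B N. c w < r" for c
    proof
      assume "focused c A x N (Suc r)"
      then obtain f V where V: "finite V" "card V = Suc r"
        "\<forall>v\<in>V. \<exists>t\<in>lines ?B N. point x t = f \<and> (\<forall>a\<in>A. c (point a t) = v)"
        unfolding focused_def by (elim bexE exE conjE)
      have "V \<subseteq> {..<r}"
      proof
        fix v assume "v \<in> V"
        then obtain t where t: "t \<in> lines ?B N" "c (point a0 t) = v" using V(3) a0 by blast
        then show "v \<in> {..<r}" using c point_in_words[OF t(1), of a0] a0 by auto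
      qed
      then have "card V \<le> r" using card_mono[of "{..<r}" V] by simp
      with V(2) show False by simp
    qed
    with N show ?thesis unfolding HJ_for_def by blast
  qed
qed

section \<open>Echelon matrices with prescribed pivots\<close>

text \<open>The working form of RCEF with full column rank: the pivot rows are explicit, the spans
  are replaced by zero entries above the pivots, and no rank has to be mentioned.
  \<open>Ech_eq_echelons\<close> gives the link to \<open>Ech\<close>.\<close>

definition echelon :: "nat \<Rightarrow> nat \<Rightarrow> (nat \<Rightarrow> nat) \<Rightarrow> 'a::field mat \<Rightarrow> bool" where
  "echelon n k p A \<longleftrightarrow> A \<in> carrier_mat n k \<and> (\<forall>i i'. i < i' \<and> i' < k \<longrightarrow> p i < p i') \<and>
     (\<forall>i<k. p i < n) \<and> (\<forall>i<k. \<forall>l<k. A $$ (p i, l) = (if l = i then 1 else 0)) \<and>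
     (\<forall>i<k. \<forall>j<p i. A $$ (j, i) = 0)"

definition echelons :: "nat \<Rightarrow> nat \<Rightarrow> 'a::field mat set" where
  "echelons n k = {A. \<exists>p. echelon n k p A}"

lemma echelonsI: "echelon n k p A \<Longrightarrow> A \<in> echelons n k"
  by (auto simp: echelons_def)

lemma echelonD:
  assumes "echelon n k p A"
  shows "A \<in> carrier_mat n k"
    and "\<And>i i'. i < i' \<Longrightarrow> i' < k \<Longrightarrow> p i < p i'"
    and "\<And>i. i < k \<Longrightarrow> p i < n"
    and "\<And>i l. i < k \<Longrightarrow> l < k \<Longrightarrow> A $$ (p i, l) = (if l = i then 1 else 0)"
    and "\<And>i j. i < k \<Longrightarrow> j < p i \<Longrightarrow> A $$ (j, i) = 0"
  using assms unfolding echelon_def by blast+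

lemma echelons_carrier: "A \<in> echelons n k \<Longrightarrow> A \<in> carrier_mat n k"
  by (auto simp: echelons_def echelon_def)

lemma echelon_pivot_mono:
  assumes "echelon n k p A" "i \<le> j" "j < k"
  shows "p i \<le> p j"
  using echelonD(2)[OF assms(1), of i j] assms(2,3) by (cases "i = j") auto

lemma echelon_pivot_ge:
  assumes "echelon n k p A"
  shows "i < k \<Longrightarrow> i \<le> p i"
proof (induction i)
  case (Suc i)
  then show ?case using echelonD(2)[OF assms, of i "Suc i"] by simp
qed simp

lemma echelon_le:
  assumes "echelon n k p A"
  shows "k \<le> n"
proof (cases k)
  case (Suc j)
  then show ?thesis
    using echelon_pivot_ge[OF assms, of j] echelonD(3)[OF assms, of j] by simp
qed simp

lemma mult_mat_entry:
  fixes A B :: "'a::semiring_0 mat"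
  assumes "A \<in> carrier_mat n m" "B \<in> carrier_mat m k" "i < n" "j < k"
  shows "(A * B) $$ (i, j) = (\<Sum>t<m. A $$ (i, t) * B $$ (t, j))"
  using assms by (auto simp: scalar_prod_def atLeast0LessThan intro!: sum.cong)

lemma mult_unit_row:
  fixes A B :: "'a::semiring_1 mat"
  assumes "A \<in> carrier_mat n m" "B \<in> carrier_mat m k" "i < n" "j < k" "s < m"
    and "\<And>t. t < m \<Longrightarrow> A $$ (i, t) = (if t = s then 1 else 0)"
  shows "(A * B) $$ (i, j) = B $$ (s, j)"
proof -
  have "(A * B) $$ (i, j) = (\<Sum>t<m. if t = s then B $$ (t, j) else 0)"
    unfolding mult_mat_entry[OF assms(1-4)] by (intro sum.cong) (auto simp: assms(6))
  then show ?thesis using assms(5) by simp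
qed

text \<open>Row \<open>p (q i)\<close> of \<open>R\<close> is the unit row at \<open>q i\<close>, so
  it copies the pivot row \<open>q i\<close> of \<open>A\<close>. Above it, each summand vanishes:
  for t < \<open>q i\<close> because of \<open>A\<close>, and for t at least \<open>q i\<close>
  because of \<open>R\<close>.\<close>

lemma echelon_mult:
  assumes R: "echelon n m p R" and A: "echelon m k q A"
  shows "echelon n k (p \<circ> q) (R * A)"
  unfolding echelon_def
proof (intro conjI allI impI)
  note R1 = echelonD(1)[OF R] and A1 = echelonD(1)[OF A]
  show "R * A \<in> carrier_mat n k" using R1 A1 by simp
  show "(p \<circ> q) i < (p \<circ> q) i'" if "i < i' \<and> i' < k" for i i'
    using that echelonD(2,3)[OF A] echelonD(2)[OF R] by simp
  show "(p \<circ> q) i < n" if "i < k" for i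
    using that echelonD(3)[OF A] echelonD(3)[OF R] by simp
  show "(R * A) $$ ((p \<circ> q) i, l) = (if l = i then 1 else 0)" if "i < k" "l < k" for i l
  proof -
    have qi: "q i < m" "p (q i) < n" using that echelonD(3)[OF A] echelonD(3)[OF R] by auto
    have "(R * A) $$ (p (q i), l) = A $$ (q i, l)"
      using mult_unit_row[OF R1 A1 qi(2) that(2) qi(1)] echelonD(4)[OF R qi(1)] by blast
    then show ?thesis using echelonD(4)[OF A] that by simp
  qed
  show "(R * A) $$ (j, i) = 0" if "i < k" "j < (p \<circ> q) i" for i j
  proof -
    have qi: "q i < m" "p (q i) < n" using that echelonD(3)[OF A] echelonD(3)[OF R] by auto
    have z: "R $$ (j, t) * A $$ (t, i) = 0" if "t < m" for t
    proof (cases "t < q i")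
      case True
      then show ?thesis using echelonD(5)[OF A \<open>i < k\<close>] by simp
    next
      case False
      then have "p (q i) \<le> p t" using echelon_pivot_mono[OF R] that by simp
      then show ?thesis using echelonD(5)[OF R that] \<open>j < (p \<circ> q) i\<close> by simp
    qed
    have "j < n" using that(2) qi(2) by simp
    then have "(R * A) $$ (j, i) = (\<Sum>t<m. R $$ (j, t) * A $$ (t, i))"
      using mult_mat_entry[OF R1 A1 _ that(1)] by blast
    then show ?thesis using z by simp
  qed
qed

lemma echelons_mult: "R \<in> echelons n m \<Longrightarrow> A \<in> echelons m k \<Longrightarrow> R * A \<in> echelons n k"
  unfolding echelons_def using echelon_mult by blast

text \<open>For injective \<open>h\<close>, left multiplication moves row j to row
  \<open>h j\<close> and puts zeros elsewhere; for \<open>h = id\<close> it appends zero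
  rows.\<close>

definition sel_mat :: "nat \<Rightarrow> nat \<Rightarrow> (nat \<Rightarrow> nat) \<Rightarrow> 'a::field mat" where
  "sel_mat n m h = mat n m (\<lambda>(i, j). if i = h j then 1 else 0)"

lemma echelon_sel_mat:
  assumes "strict_mono_on {..<m} h" "\<And>i. i < m \<Longrightarrow> h i < n"
  shows "echelon n m h (sel_mat n m h)"
proof -
  have m: "h i < h i'" if "i < i'" "i' < m" for i i'
    using strict_mono_onD[OF assms(1), of i i'] that by simp
  have "i = l" if "h i = h l" "i < m" "l < m" for i l
    using m[of i l] m[of l i] that by (cases i l rule: linorder_cases) auto
  then show ?thesis using assms(2) m unfolding echelon_def sel_mat_def by force
qed

lemma echelon_sel_mat_id: "m \<le> n \<Longrightarrow> echelon n m id (sel_mat n m id)"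
  by (rule echelon_sel_mat) (auto simp: strict_mono_on_def)

lemma sel_mat_in_echelons: "m \<le> n \<Longrightarrow> sel_mat n m id \<in> echelons n m"
  using echelon_sel_mat_id echelonsI by blast

lemma one_mat_in_echelons: "(1\<^sub>m n :: 'a::field mat) \<in> echelons n n"
proof -
  have "(1\<^sub>m n :: 'a mat) = sel_mat n n id" by (auto simp: sel_mat_def)
  then show ?thesis by (simp only: sel_mat_in_echelons order.refl)
qed

section \<open>Making the rows below the last pivot irrelevant\<close>

text \<open>The number of columns is \<open>Suc k\<close> so that a last pivot \<open>q k\<close>
  exists. The bound \<open>i\<close> is a parameter because independence of the rows below is
  achieved for one position of the last pivot at a time.\<close>

definition depends_on_head :: "nat \<Rightarrow> nat \<Rightarrow> nat \<Rightarrow> ('a::field mat \<Rightarrow> nat) \<Rightarrow> bool" where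
  "depends_on_head k i M c \<longleftrightarrow> (\<forall>B B' q q'. echelon M (Suc k) q B \<longrightarrow> echelon M (Suc k) q' B' \<longrightarrow>
     q k = q' k \<longrightarrow> q k < i \<longrightarrow> (\<forall>j\<le>q k. \<forall>l\<le>k. B $$ (j, l) = B' $$ (j, l)) \<longrightarrow> c B = c B')"

lemma depends_on_headD:
  assumes "depends_on_head k i M c" "echelon M (Suc k) q B" "echelon M (Suc k) q' B'"
    "q k = q' k" "q k < i" "\<And>j l. j \<le> q k \<Longrightarrow> l \<le> k \<Longrightarrow> B $$ (j, l) = B' $$ (j, l)"
  shows "c B = c B'"
  using assms unfolding depends_on_head_def by blast

text \<open>Right multiplication by \<open>stack i m 1 [Y]\<close> evaluates the combinatorial line encoded by
  \<open>line_mat\<close> at \<open>Y\<close>, since every variable position carries a unit block.\<close>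

definition stack :: "nat \<Rightarrow> nat \<Rightarrow> nat \<Rightarrow> 'a::field mat list \<Rightarrow> 'a mat" where
  "stack i m N w = mat (Suc i + N * m) (Suc i) (\<lambda>(j, l).
     if j \<le> i then (if l = j then 1 else 0)
     else (w ! ((j - Suc i) div m)) $$ ((j - Suc i) mod m, l))"

definition line_mat :: "nat \<Rightarrow> nat \<Rightarrow> nat \<Rightarrow> 'a::field mat option list \<Rightarrow> 'a mat" where
  "line_mat i m N t = mat (Suc i + N * m) (Suc i + m) (\<lambda>(j, l).
     if j \<le> i then (if l = j then 1 else 0)
     else case t ! ((j - Suc i) div m) of
         None \<Rightarrow> if l = Suc i + (j - Suc i) mod m then 1 else 0
       | Some X \<Rightarrow> if l \<le> i then X $$ ((j - Suc i) mod m, l) else 0)"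

lemma echelon_stack: "echelon (Suc i + N * m) (Suc i) id (stack i m N w)"
  unfolding echelon_def stack_def by auto

lemma block_index:
  assumes "(j::nat) < Suc i + N * m" "\<not> j \<le> i"
  shows "(j - Suc i) div m < N" "(j - Suc i) mod m < m"
proof -
  have *: "j - Suc i < N * m" using assms by simp
  show "(j - Suc i) div m < N" using less_mult_imp_div_less[OF *] .
  have "m > 0" using * by (cases m) auto
  then show "(j - Suc i) mod m < m" by simp
qed

text \<open>The last \<open>m\<close> columns have their pivots in the first variable block, which
  has number \<open>a\<close> and exists because a line contains the variable. The constant blocks
  vanish in these columns, and later variable blocks only contribute entries below the
  pivots.\<close>

lemma echelon_line_mat:
  assumes t: "length t = N" "None \<in> set t"
  shows "\<exists>p. echelon (Suc i + N * m) (Suc i + m) p (line_mat i m N t) \<and> (\<forall>j\<le>i. p j = j)"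
proof -
  define a where "a = (LEAST a. a < N \<and> t ! a = None)"
  have "\<exists>a. a < N \<and> t ! a = None" using t by (metis in_set_conv_nth)
  then have a: "a < N" "t ! a = None" unfolding a_def by (metis (mono_tags, lifting) LeastI)+
  have least: "a \<le> b" if "b < N" "t ! b = None" for b
    unfolding a_def using that by (simp add: Least_le)
  define p where "p = (\<lambda>j. if j \<le> i then j else j + a * m)"
  have "Suc a * m \<le> N * m" using a(1) by (intro mult_right_mono) auto
  then have bd: "a * m + m \<le> N * m" by simp
  have "echelon (Suc i + N * m) (Suc i + m) p (line_mat i m N t)"
    unfolding echelon_def
  proof (intro conjI allI impI)
    show "line_mat i m N t \<in> carrier_mat (Suc i + N * m) (Suc i + m)"
      by (simp add: line_mat_def)
    show "p b < p b'" if "b < b' \<and> b' < Suc i + m" for b b'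
      using that unfolding p_def by auto
    show *: "p b < Suc i + N * m" if "b < Suc i + m" for b
      using that bd unfolding p_def by auto
    show "line_mat i m N t $$ (p b, l) = (if l = b then 1 else 0)"
      if b: "b < Suc i + m" and l: "l < Suc i + m" for b l
    proof (cases "b \<le> i")
      case True
      then show ?thesis using *[OF b] l by (simp add: line_mat_def p_def)
    next
      case False
      then have s: "b - Suc i < m" and "p b = b + a * m" using b unfolding p_def by auto
      then have e: "p b - Suc i = (b - Suc i) + a * m" using False by simp
      have "(p b - Suc i) div m = a" "(p b - Suc i) mod m = b - Suc i"
        unfolding e using s by (auto simp: div_mult_self3)
      then show ?thesis using *[OF b] l False a(2) by (simp add: line_mat_def p_def)
    qed
    show "line_mat i m N t $$ (j, b) = 0" if b: "b < Suc i + m" and j: "j < p b" for b j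
    proof (cases "b \<le> i \<or> j \<le> i")
      case True
      then show ?thesis using *[OF b] j b by (auto simp: line_mat_def p_def split: if_splits)
    next
      case False
      have jn: "j < Suc i + N * m" using *[OF b] j by simp
      note bl = block_index[OF jn]
      show ?thesis
      proof (cases "t ! ((j - Suc i) div m)")
        case None
        then have ge: "a \<le> (j - Suc i) div m" using least bl False by simp
        have "j - Suc i = (j - Suc i) div m * m + (j - Suc i) mod m" by simp
        moreover have "a * m \<le> (j - Suc i) div m * m" using ge by simp
        ultimately have "a * m + (j - Suc i) mod m \<le> j - Suc i" by linarith
        then have "b \<noteq> Suc i + (j - Suc i) mod m" using j False unfolding p_def by auto
        then show ?thesis using jn b None False by (simp add: line_mat_def)
      next
        case (Some X)
        then show ?thesis using jn b False by (simp add: line_mat_def)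
      qed
    qed
  qed
  then show ?thesis by (intro exI[of _ p]) (auto simp: p_def)
qed

lemma line_mat_stack:
  assumes t: "length t = N" and Y: "Y \<in> carrier_mat m (Suc i)"
  shows "line_mat i m N t * stack i m 1 [Y] = stack i m N (point Y t)"
proof (rule eq_matI)
  have L: "line_mat i m N t \<in> carrier_mat (Suc i + N * m) (Suc i + m)"
    by (simp add: line_mat_def)
  have S: "stack i m 1 [Y] \<in> carrier_mat (Suc i + m) (Suc i)" by (simp add: stack_def)
  fix j l assume "j < dim_row (stack i m N (point Y t))" "l < dim_col (stack i m N (point Y t))"
  then have j: "j < Suc i + N * m" and l: "l < Suc i" by (auto simp: stack_def)
  have top: "stack i m 1 [Y] $$ (a, l) = (if l = a then 1 else 0)" if "a \<le> i" for a
    using that l by (simp add: stack_def)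
  show "(line_mat i m N t * stack i m 1 [Y]) $$ (j, l) = stack i m N (point Y t) $$ (j, l)"
  proof (cases "j \<le> i")
    case True
    have "(line_mat i m N t * stack i m 1 [Y]) $$ (j, l) = stack i m 1 [Y] $$ (j, l)"
      by (rule mult_unit_row[OF L S j l]) (use True in \<open>auto simp: line_mat_def\<close>)
    then show ?thesis using True top j l by (simp add: stack_def)
  next
    case False
    let ?d = "(j - Suc i) div m" and ?s = "(j - Suc i) mod m"
    have d: "?d < N" and s: "?s < m" using block_index[OF j False] by auto
    have pt: "point Y t ! ?d = (case t ! ?d of None \<Rightarrow> Y | Some X \<Rightarrow> X)"
      using d t by (simp add: point_def split: option.split)
    show ?thesis
    proof (cases "t ! ?d")
      case None
      have "(line_mat i m N t * stack i m 1 [Y]) $$ (j, l) = stack i m 1 [Y] $$ (Suc i + ?s, l)"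
        by (rule mult_unit_row[OF L S j l]) (use False s None j in \<open>auto simp: line_mat_def\<close>)
      also have "\<dots> = Y $$ (?s, l)" using s l by (simp add: stack_def)
      finally show ?thesis using False pt None j l by (simp add: stack_def)
    next
      case (Some X)
      \<comment> \<open>A constant block is supported on the first \<open>Suc i\<close> columns;
        there \<open>stack\<close> has identity rows and reproduces \<open>X\<close>, and
        \<open>Y\<close> is not seen.\<close>
      have "(line_mat i m N t * stack i m 1 [Y]) $$ (j, l)
        = (\<Sum>a<Suc i + m. line_mat i m N t $$ (j, a) * stack i m 1 [Y] $$ (a, l))"
        by (rule mult_mat_entry[OF L S j l])
      also have "\<dots> = (\<Sum>a<Suc i + m. if a = l then X $$ (?s, l) else 0)"
      proof (intro sum.cong refl)
        fix a assume "a \<in> {..<Suc i + m}"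
        then show "line_mat i m N t $$ (j, a) * stack i m 1 [Y] $$ (a, l)
          = (if a = l then X $$ (?s, l) else 0)"
          using False Some j l top[of a] by (cases "a \<le> i") (auto simp: line_mat_def)
      qed
      also have "\<dots> = X $$ (?s, l)" using l by simp
      finally show ?thesis using False pt Some j l by (simp add: stack_def)
    qed
  qed
qed (auto simp: line_mat_def stack_def)

definition head :: "nat \<Rightarrow> 'a mat \<Rightarrow> 'a mat" where
  "head n B = mat n (dim_col B) (\<lambda>ij. B $$ ij)"

lemma echelon_head:
  assumes "echelon M (Suc k) q B" "q k < n" "n \<le> M"
  shows "echelon n (Suc k) q (head n B)"
proof -
  have b: "q i < n" if "i < Suc k" for i
    using echelon_pivot_mono[OF assms(1), of i k] that assms(2) by simp
  then have "j < n" if "i < Suc k" "j < q i" for i j using that order.strict_trans by blast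
  with b show ?thesis using assms(1,3) unfolding echelon_def head_def by auto
qed

text \<open>The rows up to the last pivot contain a unit basis, hence span all the later rows.\<close>

lemma echelon_eq_stack_mult:
  fixes B :: "'a::field mat"
  assumes B: "echelon (Suc i + m) (Suc k) q B" and i: "q k = i"
  shows "\<exists>Y \<in> carrier_mat m (Suc i). B = stack i m 1 [Y] * head (Suc i) B"
proof
  \<comment> \<open>Since row \<open>q l\<close> of \<open>B\<close> is the unit row at l, a row of
    \<open>B\<close> is the combination of the pivot rows whose coefficients are its own entries. So
    \<open>Y\<close> has these entries in the columns \<open>q l\<close> and zeros
    elsewhere.\<close>
  define Y :: "'a mat" where "Y = mat m (Suc i) (\<lambda>(s, a). \<Sum>l<Suc k. if a = q l then B $$ (Suc (i + s), l) else 0)"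
  show "Y \<in> carrier_mat m (Suc i)" by (simp add: Y_def)
  note B1 = echelonD(1)[OF B]
  have S: "stack i m 1 [Y] \<in> carrier_mat (Suc i + m) (Suc i)" by (simp add: stack_def)
  have H: "head (Suc i) B \<in> carrier_mat (Suc i) (Suc k)" using B1 by (simp add: head_def)
  show "B = stack i m 1 [Y] * head (Suc i) B"
  proof (rule eq_matI)
    fix j l assume "j < dim_row (stack i m 1 [Y] * head (Suc i) B)"
      "l < dim_col (stack i m 1 [Y] * head (Suc i) B)"
    then have j: "j < Suc i + m" and l: "l < Suc k" using S H by auto
    show "B $$ (j, l) = (stack i m 1 [Y] * head (Suc i) B) $$ (j, l)"
    proof (cases "j \<le> i")
      case True
      have "(stack i m 1 [Y] * head (Suc i) B) $$ (j, l) = head (Suc i) B $$ (j, l)"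
        by (rule mult_unit_row[OF S H j l]) (use True in \<open>auto simp: stack_def\<close>)
      then show ?thesis using True l B1 by (simp add: head_def)
    next
      case False
      define s where "s = j - Suc i"
      have s: "s < m" "j = Suc (i + s)" using False j unfolding s_def by auto
      have q: "q b < Suc i" if "b < Suc k" for b
        using echelon_pivot_mono[OF B, of b k] that i by simp
      have "(stack i m 1 [Y] * head (Suc i) B) $$ (j, l)
        = (\<Sum>a<Suc i. stack i m 1 [Y] $$ (j, a) * head (Suc i) B $$ (a, l))"
        by (rule mult_mat_entry[OF S H j l])
      also have "\<dots> = (\<Sum>a<Suc i. \<Sum>b<Suc k. if a = q b then B $$ (j, b) * B $$ (a, l) else 0)"
      proof (intro sum.cong refl)
        fix a assume a: "a \<in> {..<Suc i}"
        then have "stack i m 1 [Y] $$ (j, a) = (\<Sum>b<Suc k. if a = q b then B $$ (j, b) else 0)"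
          using s(1) unfolding s(2) by (simp add: stack_def Y_def del: sum.lessThan_Suc)
        moreover have "head (Suc i) B $$ (a, l) = B $$ (a, l)"
          using a l B1 by (simp add: head_def)
        ultimately show "stack i m 1 [Y] $$ (j, a) * head (Suc i) B $$ (a, l)
          = (\<Sum>b<Suc k. if a = q b then B $$ (j, b) * B $$ (a, l) else 0)"
          by (simp add: sum_distrib_right if_distribR del: sum.lessThan_Suc cong: if_cong)
             (intro sum.cong, auto)
      qed
      also have "\<dots> = (\<Sum>b<Suc k. \<Sum>a<Suc i. if a = q b then B $$ (j, b) * B $$ (a, l) else 0)"
        by (rule sum.swap)
      also have "\<dots> = (\<Sum>b<Suc k. if b = l then B $$ (j, b) else 0)"
      proof (intro sum.cong refl)
        fix b assume "b \<in> {..<Suc k}"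
        then have b: "b < Suc k" by simp
        have "(\<Sum>a<Suc i. if a = q b then B $$ (j, b) * B $$ (a, l) else 0)
          = B $$ (j, b) * B $$ (q b, l)"
          using q[OF b] by (simp add: sum.delta del: sum.lessThan_Suc)
        then show "(\<Sum>a<Suc i. if a = q b then B $$ (j, b) * B $$ (a, l) else 0)
          = (if b = l then B $$ (j, b) else 0)"
          using echelonD(4)[OF B b l] by simp
      qed
      also have "\<dots> = B $$ (j, l)" using l by (simp add: sum.delta del: sum.lessThan_Suc)
      finally show ?thesis by simp
    qed
  qed (use B1 S H in auto)
qed

text \<open>Matrices with the same head D and last pivot \<open>i\<close> are
  \<open>stack i m 1 [Y] * D\<close> with different \<open>Y\<close>. Multiplied by
  \<open>line_mat\<close> they become points of one combinatorial line, times D. The condition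
  \<open>p j = j\<close> is recorded so that this restriction can be made after those for smaller
  pivot positions.\<close>

lemma mono_last_pivot_at:
  fixes i m k r :: nat
  shows "\<exists>N. \<forall>c :: 'a::{finite,field} mat \<Rightarrow> nat.
    (\<forall>A\<in>echelons (Suc i + N) (Suc k). c A < r) \<longrightarrow>
    (\<exists>R p. echelon (Suc i + N) (Suc i + m) p R \<and> (\<forall>j\<le>i. p j = j) \<and>
       (\<forall>B B' q q'. echelon (Suc i + m) (Suc k) q B \<longrightarrow> echelon (Suc i + m) (Suc k) q' B' \<longrightarrow>
          q k = i \<longrightarrow> q' k = i \<longrightarrow> head (Suc i) B = head (Suc i) B' \<longrightarrow> c (R * B) = c (R * B')))"
proof -
  \<comment> \<open>The letters are the coefficient matrices of \<open>m\<close> rows relative to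
    the first \<open>Suc i\<close> rows. The colour of a word is the family of colours over all
    heads in \<open>?U\<close>, so one line serves every head.\<close>
  let ?L = "carrier_mat m (Suc i) :: 'a mat set"
  let ?U = "echelons (Suc i) (Suc k) :: 'a mat set"
  have "?U \<subseteq> carrier_mat (Suc i) (Suc k)" using echelons_carrier by blast
  then have "finite ?U" using finite_carrier_mat finite_subset by blast
  from encode_colour_family[where r = r and ?'x = "'a mat list", OF this]
  obtain r' where r': "\<forall>(F :: 'a mat list \<Rightarrow> 'a mat \<Rightarrow> nat) X. (\<forall>x\<in>X. \<forall>u\<in>?U. F x u < r) \<longrightarrow>
    (\<exists>c. (\<forall>x\<in>X. c x < (r'::nat)) \<and>
         (\<forall>x\<in>X. \<forall>y\<in>X. c x = c y \<longrightarrow> (\<forall>u\<in>?U. F x u = F y u)))" by (rule exE)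
  have "finite ?L" by (rule finite_carrier_mat)
  from hales_jewett[OF this] obtain N where N: "HJ_for ?L r' N" by blast
  show ?thesis
  proof (intro exI[of _ "N * m"] allI impI)
    fix c :: "'a mat \<Rightarrow> nat" assume c: "\<forall>A\<in>echelons (Suc i + N * m) (Suc k). c A < r"
    have "\<forall>w\<in>words ?L N. \<forall>D\<in>?U. c (stack i m N w * D) < r"
      using c echelons_mult[OF echelonsI[OF echelon_stack]] by blast
    from r'[THEN spec[of _ "\<lambda>w D. c (stack i m N w * D)"], THEN spec[of _ "words ?L N"],
        THEN mp, OF this]
    obtain d where d: "\<forall>w\<in>words ?L N. d w < r'"
      "\<forall>w\<in>words ?L N. \<forall>w'\<in>words ?L N. d w = d w' \<longrightarrow>
        (\<forall>D\<in>?U. c (stack i m N w * D) = c (stack i m N w' * D))"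
      by (elim exE conjE)
    from N[unfolded HJ_for_def, THEN spec[of _ d], THEN mp, OF d(1)]
    obtain t where t: "t \<in> lines ?L N" "mono_line d ?L t" by (rule bexE)
    have tl: "length t = N" "None \<in> set t" using t(1) by (auto simp: lines_def)
    from echelon_line_mat[OF tl, of i m] obtain p where
      p: "echelon (Suc i + N * m) (Suc i + m) p (line_mat i m N t)" "\<forall>j\<le>i. p j = j" by blast
    have "c (line_mat i m N t * B) = c (line_mat i m N t * B')"
      if B: "echelon (Suc i + m) (Suc k) q B" "q k = i"
        and B': "echelon (Suc i + m) (Suc k) q' B'" "q' k = i"
        and eq: "head (Suc i) B = head (Suc i) B'" for B B' q q'
    proof -
      let ?D = "head (Suc i) B"
      obtain Y where Y: "Y \<in> ?L" "B = stack i m 1 [Y] * ?D"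
        using echelon_eq_stack_mult[OF B] by blast
      obtain Y' where Y': "Y' \<in> ?L" "B' = stack i m 1 [Y'] * ?D"
        using echelon_eq_stack_mult[OF B'] eq by auto
      have "echelon (Suc i) (Suc k) q ?D" using echelon_head[OF B(1)] B(2) by simp
      then have D: "?D \<in> ?U" by (rule echelonsI)
      have *: "line_mat i m N t * (stack i m 1 [Z] * ?D) = stack i m N (point Z t) * ?D"
        if "Z \<in> ?L" for Z
      proof -
        have "line_mat i m N t * (stack i m 1 [Z] * ?D) = line_mat i m N t * stack i m 1 [Z] * ?D"
          using echelonD(1)[OF p(1)] echelonD(1)[OF echelon_stack[of i 1 m "[Z]"]]
            echelons_carrier[OF D] by (intro assoc_mult_mat[symmetric]) auto
        then show ?thesis using line_mat_stack[OF tl(1) that] by simp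
      qed
      have "d (point Y t) = d (point Y' t)" using t(2) Y(1) Y'(1) unfolding mono_line_def by blast
      with d(2) point_in_words[OF t(1) Y(1)] point_in_words[OF t(1) Y'(1)]
      have "\<forall>D\<in>?U. c (stack i m N (point Y t) * D) = c (stack i m N (point Y' t) * D)"
        by (metis (no_types, lifting))
      with D have "c (stack i m N (point Y t) * ?D) = c (stack i m N (point Y' t) * ?D)" by blast
      then show ?thesis using *[OF Y(1)] *[OF Y'(1)] Y(2) Y'(2) by metis
    qed
    with p show "\<exists>R p. echelon (Suc i + N * m) (Suc i + m) p R \<and> (\<forall>j\<le>i. p j = j) \<and>
       (\<forall>B B' q q'. echelon (Suc i + m) (Suc k) q B \<longrightarrow> echelon (Suc i + m) (Suc k) q' B' \<longrightarrow>
          q k = i \<longrightarrow> q' k = i \<longrightarrow> head (Suc i) B = head (Suc i) B' \<longrightarrow> c (R * B) = c (R * B'))"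
      by (intro exI[of _ "line_mat i m N t"] exI[of _ p]) blast
  qed
qed

text \<open>In the step, \<open>R0\<close> takes care of the last pivots before \<open>i\<close> and
  leaves enough rows for \<open>R1\<close> to take care of the position \<open>i\<close> itself. So
  the size \<open>N1\<close> for \<open>R1\<close> is determined first.\<close>

lemma ramsey_depends_on_head_below:
  fixes i m k r :: nat
  shows "\<exists>N. \<forall>c :: 'a::{finite,field} mat \<Rightarrow> nat. (\<forall>A\<in>echelons N (Suc k). c A < r) \<longrightarrow>
    (\<exists>R\<in>echelons N (i + m). depends_on_head k i (i + m) (\<lambda>B. c (R * B)))"
proof (induction i arbitrary: m)
  case 0
  have "depends_on_head k 0 m c" for c :: "'a mat \<Rightarrow> nat"
    by (simp add: depends_on_head_def)
  then show ?case using one_mat_in_echelons[of m] by auto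
next
  case (Suc i)
  from mono_last_pivot_at[where ?'a = 'a, of i k r m] obtain N1 where
    N1: "\<forall>c :: 'a mat \<Rightarrow> nat. (\<forall>A\<in>echelons (Suc i + N1) (Suc k). c A < r) \<longrightarrow>
    (\<exists>R p. echelon (Suc i + N1) (Suc i + m) p R \<and> (\<forall>j\<le>i. p j = j) \<and>
       (\<forall>B B' q q'. echelon (Suc i + m) (Suc k) q B \<longrightarrow> echelon (Suc i + m) (Suc k) q' B' \<longrightarrow>
          q k = i \<longrightarrow> q' k = i \<longrightarrow> head (Suc i) B = head (Suc i) B' \<longrightarrow> c (R * B) = c (R * B')))"
    by (rule exE)
  from Suc.IH[of "Suc N1"] obtain N where
    N: "\<forall>c :: 'a mat \<Rightarrow> nat. (\<forall>A\<in>echelons N (Suc k). c A < r) \<longrightarrow>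
    (\<exists>R\<in>echelons N (i + Suc N1). depends_on_head k i (i + Suc N1) (\<lambda>B. c (R * B)))"
    by (rule exE)
  show ?case
  proof (intro exI[of _ N] allI impI)
    fix c :: "'a mat \<Rightarrow> nat" assume c: "\<forall>A\<in>echelons N (Suc k). c A < r"
    from N[THEN spec[of _ c], THEN mp, OF c] obtain R0 where
      R0: "R0 \<in> echelons N (Suc i + N1)" "depends_on_head k i (Suc i + N1) (\<lambda>B. c (R0 * B))"
      by auto
    have "\<forall>A\<in>echelons (Suc i + N1) (Suc k). c (R0 * A) < r"
      using c echelons_mult[OF R0(1)] by blast
    from N1[THEN spec[of _ "\<lambda>B. c (R0 * B)"], THEN mp, OF this] obtain R1 p where
      R1: "echelon (Suc i + N1) (Suc i + m) p R1" and p: "\<forall>j\<le>i. p j = j" and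
      mono: "\<forall>B B' q q'. echelon (Suc i + m) (Suc k) q B \<longrightarrow> echelon (Suc i + m) (Suc k) q' B' \<longrightarrow>
          q k = i \<longrightarrow> q' k = i \<longrightarrow> head (Suc i) B = head (Suc i) B' \<longrightarrow>
          c (R0 * (R1 * B)) = c (R0 * (R1 * B'))" by (elim exE conjE)
    \<comment> \<open>The rows up to \<open>i\<close> of \<open>R1\<close> are unit rows, hence they
      copy the rows of \<open>B\<close>.\<close>
    have top: "(R1 * B) $$ (j, l) = B $$ (j, l)"
      if "j \<le> i" "l \<le> k" "B \<in> carrier_mat (Suc i + m) (Suc k)" for j l and B :: "'a mat"
      by (rule mult_unit_row[OF echelonD(1)[OF R1] that(3)])
        (use that p echelonD(3)[OF R1, of j] echelonD(4)[OF R1, of j] in auto)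
    have "c (R0 * R1 * B) = c (R0 * R1 * B')"
      if B: "echelon (Suc i + m) (Suc k) q B" and B': "echelon (Suc i + m) (Suc k) q' B'"
        and q: "q k = q' k" "q k < Suc i" and eq: "\<forall>j\<le>q k. \<forall>l\<le>k. B $$ (j, l) = B' $$ (j, l)"
      for B B' q q'
    proof -
      note B1 = echelonD(1)[OF B] and B'1 = echelonD(1)[OF B']
      have as: "R0 * R1 * Z = R0 * (R1 * Z)" if "Z \<in> carrier_mat (Suc i + m) (Suc k)" for Z
        using echelons_carrier[OF R0(1)] echelonD(1)[OF R1] that by (rule assoc_mult_mat)
      have "c (R0 * (R1 * B)) = c (R0 * (R1 * B'))"
      proof (cases "q k = i")
        case True
        have "head (Suc i) B = head (Suc i) B'"
          using eq True B1 B'1 by (auto simp: head_def)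
        then show ?thesis using mono B B' q True by metis
      next
        case False
        then have lt: "q k < i" using q by simp
        show ?thesis
        \<comment> \<open>For a last pivot before \<open>i\<close>, multiplication by
          \<open>R1\<close> changes neither its position nor the rows up to it, so the property of
          \<open>R0\<close> is preserved.\<close>
        proof (rule depends_on_headD[OF R0(2) echelon_mult[OF R1 B] echelon_mult[OF R1 B']])
          show "(p \<circ> q) k = (p \<circ> q') k" using q by simp
          show "(p \<circ> q) k < i" using lt p by simp
          show "(R1 * B) $$ (j, l) = (R1 * B') $$ (j, l)" if "j \<le> (p \<circ> q) k" "l \<le> k" for j l
            using that lt p top[OF _ _ B1] top[OF _ _ B'1] eq by simp
        qed
      qed
      then show ?thesis using as B1 B'1 by simp
    qed
    then have "depends_on_head k (Suc i) (Suc i + m) (\<lambda>B. c (R0 * R1 * B))"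
      unfolding depends_on_head_def by blast
    moreover have "R0 * R1 \<in> echelons N (Suc i + m)"
      using echelons_mult[OF R0(1) echelonsI[OF R1]] .
    ultimately show "\<exists>R\<in>echelons N (Suc i + m). depends_on_head k (Suc i) (Suc i + m) (\<lambda>B. c (R * B))"
      by blast
  qed
qed

section \<open>The Graham--Leeb--Rothschild theorem in echelon form\<close>

text \<open>Rows of \<open>R\<close> up to \<open>p (q k)\<close> vanish in all columns after
  \<open>q k\<close>. So the rows of \<open>R * B\<close> up to its last pivot only involve the rows
  of \<open>B\<close> up to its last pivot.\<close>

lemma depends_on_head_mult:
  fixes R :: "'a::field mat" and c :: "'a mat \<Rightarrow> nat"
  assumes R: "echelon N M p R" and c: "depends_on_head k N N c"
  shows "depends_on_head k M M (\<lambda>B. c (R * B))"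
  unfolding depends_on_head_def
proof (intro allI impI)
  fix B B' :: "'a mat" and q q'
  assume B: "echelon M (Suc k) q B" and B': "echelon M (Suc k) q' B'"
    and q: "q k = q' k" "q k < M" and eq: "\<forall>j\<le>q k. \<forall>l\<le>k. B $$ (j, l) = B' $$ (j, l)"
  have pq: "p (q k) < N" using echelonD(3)[OF R q(2)] .
  show "c (R * B) = c (R * B')"
  proof (rule depends_on_headD[OF c echelon_mult[OF R B] echelon_mult[OF R B']])
    show "(p \<circ> q) k = (p \<circ> q') k" "(p \<circ> q) k < N" using q pq by simp_all
    show "(R * B) $$ (j, l) = (R * B') $$ (j, l)" if j: "j \<le> (p \<circ> q) k" and l: "l \<le> k" for j l
    proof -
      have jN: "j < N" and lk: "l < Suc k" using j pq l by auto
      have z: "R $$ (j, t) * B $$ (t, l) = R $$ (j, t) * B' $$ (t, l)" if t: "t < M" for t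
      proof (cases "t \<le> q k")
        case True
        then show ?thesis using eq l by simp
      next
        case False
        then have "p (q k) < p t" using echelonD(2)[OF R _ t] by simp
        then show ?thesis using echelonD(5)[OF R t] j by simp
      qed
      show ?thesis
        unfolding mult_mat_entry[OF echelonD(1)[OF R] echelonD(1)[OF B] jN lk]
          mult_mat_entry[OF echelonD(1)[OF R] echelonD(1)[OF B'] jN lk]
        using z by (intro sum.cong) auto
    qed
  qed
qed

section \<open>Reduction to the position of the last pivot\<close>

text \<open>The block sum of \<open>X\<close> with the 1 x 1 identity. Applied to echelon matrices
  it yields exactly the echelon matrices whose last pivot lies in the last row; this is how the case
  of k columns enters that of \<open>Suc k\<close> columns.\<close>

definition ext_mat :: "'a::field mat \<Rightarrow> 'a mat" where
  "ext_mat X = mat (Suc (dim_row X)) (Suc (dim_col X)) (\<lambda>(i, j).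
     if i < dim_row X \<and> j < dim_col X then X $$ (i, j)
     else if i = dim_row X \<and> j = dim_col X then 1 else 0)"

lemma ext_mat_carrier: "X \<in> carrier_mat n k \<Longrightarrow> ext_mat X \<in> carrier_mat (Suc n) (Suc k)"
  by (auto simp: ext_mat_def)

lemma ext_mat_entry:
  "X \<in> carrier_mat n k \<Longrightarrow> i < Suc n \<Longrightarrow> j < Suc k \<Longrightarrow>
    ext_mat X $$ (i, j) = (if i < n \<and> j < k then X $$ (i, j) else if i = n \<and> j = k then 1 else 0)"
  by (auto simp: ext_mat_def)

lemma ext_mat_mult:
  assumes X: "X \<in> carrier_mat n m" and Y: "Y \<in> carrier_mat m k"
  shows "ext_mat (X * Y) = ext_mat X * ext_mat Y"
proof (rule eq_matI)
  note eX = ext_mat_carrier[OF X] and eY = ext_mat_carrier[OF Y]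
  have XY: "X * Y \<in> carrier_mat n k" using X Y by simp
  fix i j assume "i < dim_row (ext_mat X * ext_mat Y)" "j < dim_col (ext_mat X * ext_mat Y)"
  then have i: "i < Suc n" and j: "j < Suc k" using eX eY by auto
  have "(ext_mat X * ext_mat Y) $$ (i, j)
    = (\<Sum>t<m. ext_mat X $$ (i, t) * ext_mat Y $$ (t, j)) + ext_mat X $$ (i, m) * ext_mat Y $$ (m, j)"
    using mult_mat_entry[OF eX eY i j] by simp
  also have "\<dots> = (if i < n \<and> j < k then (\<Sum>t<m. X $$ (i, t) * Y $$ (t, j))
      else if i = n \<and> j = k then 1 else 0)"
    using i j by (auto simp: ext_mat_entry[OF X] ext_mat_entry[OF Y] intro!: sum.neutral sum.cong)
  finally show "ext_mat (X * Y) $$ (i, j) = (ext_mat X * ext_mat Y) $$ (i, j)"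
    using i j mult_mat_entry[OF X Y] by (auto simp: ext_mat_entry[OF XY])
qed (use X Y in \<open>auto simp: ext_mat_def\<close>)

lemma echelon_ext_mat:
  assumes X: "echelon n k p X"
  shows "echelon (Suc n) (Suc k) (p(k := n)) (ext_mat X)"
proof -
  note X1 = echelonD(1)[OF X] and X3 = echelonD(3)[OF X]
  have lt: "j < n" if "i < k" "j < p i" for i j using that X3 order.strict_trans by blast
  show ?thesis
    unfolding echelon_def
  proof (intro conjI allI impI)
    show "ext_mat X \<in> carrier_mat (Suc n) (Suc k)" by (rule ext_mat_carrier[OF X1])
    show "(p(k := n)) i < (p(k := n)) i'" if "i < i' \<and> i' < Suc k" for i i'
      using that echelonD(2)[OF X] X3 by auto
    show "(p(k := n)) i < Suc n" if "i < Suc k" for i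
      using that X3[of i] by auto
    show "ext_mat X $$ ((p(k := n)) i, l) = (if l = i then 1 else 0)"
      if "i < Suc k" "l < Suc k" for i l
      using that X3[of i] echelonD(4)[OF X, of i l] by (auto simp: ext_mat_entry[OF X1])
    show "ext_mat X $$ (j, i) = 0" if "i < Suc k" "j < (p(k := n)) i" for i j
      using that lt[of i j] echelonD(5)[OF X, of i j]
      by (auto simp: ext_mat_entry[OF X1] less_Suc_eq)
  qed
qed

lemma ext_mat_echelons: "X \<in> echelons n k \<Longrightarrow> ext_mat X \<in> echelons (Suc n) (Suc k)"
  unfolding echelons_def using echelon_ext_mat by blast

text \<open>The pivot row \<open>n\<close> is a unit row and the last column vanishes above it,
  which is the block form.\<close>

lemma echelon_eq_ext_mat:
  assumes B: "echelon (Suc n) (Suc k) q B" and q: "q k = n"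
  shows "\<exists>X\<in>echelons n k. B = ext_mat X"
proof
  let ?X = "mat n k (\<lambda>ij. B $$ ij)"
  have X1: "?X \<in> carrier_mat n k" by simp
  have lt: "q i < n" if "i < k" for i using echelonD(2)[OF B that] q by simp
  then have "j < n" if "i < k" "j < q i" for i j using that order.strict_trans by blast
  with lt have "echelon n k q ?X" using B unfolding echelon_def by auto
  then show "?X \<in> echelons n k" by (rule echelonsI)
  show "B = ext_mat ?X"
  proof (rule eq_matI)
    fix i j assume "i < dim_row (ext_mat ?X)" "j < dim_col (ext_mat ?X)"
    then have i: "i < Suc n" and j: "j < Suc k" by (auto simp: ext_mat_def)
    show "B $$ (i, j) = ext_mat ?X $$ (i, j)"
      using i j echelonD(4)[OF B, of k j] echelonD(5)[OF B, of k i] q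
      by (auto simp: ext_mat_entry[OF X1] less_Suc_eq)
  qed (use echelonD(1)[OF B] in \<open>auto simp: ext_mat_def\<close>)
qed

lemma sel_mat_id_mult_entry:
  assumes "Y \<in> carrier_mat m k" "m \<le> n" "i < n" "j < k"
  shows "(sel_mat n m id * Y) $$ (i, j) = (if i < m then Y $$ (i, j) else 0)"
proof -
  have S: "sel_mat n m id \<in> carrier_mat n m" by (simp add: sel_mat_def)
  have "(sel_mat n m id * Y) $$ (i, j) = (\<Sum>t<m. if t = i then Y $$ (t, j) else 0)"
    unfolding mult_mat_entry[OF S assms(1,3,4)]
    using assms(3) by (intro sum.cong) (auto simp: sel_mat_def)
  then show ?thesis by simp
qed

text \<open>On matrices with zero last row, the block sum acts as \<open>S\<close> and keeps that
  row zero. So a restriction commutes with appending a zero row.\<close>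

lemma ext_mat_mult_sel_mat:
  assumes S: "S \<in> carrier_mat n m"
  shows "ext_mat S * sel_mat (Suc m) m id = sel_mat (Suc n) n id * S"
proof (rule eq_matI)
  have J: "sel_mat (Suc m) m id \<in> carrier_mat (Suc m) m" by (simp add: sel_mat_def)
  fix i j assume "i < dim_row (sel_mat (Suc n) n id * S)" "j < dim_col (sel_mat (Suc n) n id * S)"
  then have i: "i < Suc n" and j: "j < m" using S by (auto simp: sel_mat_def)
  have "(ext_mat S * sel_mat (Suc m) m id) $$ (i, j)
    = (\<Sum>t<Suc m. if t = j then ext_mat S $$ (i, t) else 0)"
    unfolding mult_mat_entry[OF ext_mat_carrier[OF S] J i j]
    using j by (intro sum.cong) (auto simp: sel_mat_def)
  also have "\<dots> = ext_mat S $$ (i, j)" using j by (simp add: sum.delta del: sum.lessThan_Suc)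
  finally show "(ext_mat S * sel_mat (Suc m) m id) $$ (i, j) = (sel_mat (Suc n) n id * S) $$ (i, j)"
    using sel_mat_id_mult_entry[OF S _ i j] i j by (simp add: ext_mat_entry[OF S])
qed (use S in \<open>auto simp: ext_mat_def sel_mat_def\<close>)

text \<open>Induction on the number \<open>L\<close> of rows kept. Matrices with the last pivot in
  the last row are block sums, and \<open>GLR\<close> makes these monochromatic. For every other
  matrix the last row lies below the last pivot, so \<open>depends_on_head\<close> allows replacing
  it by zeros, and one row less remains.\<close>

lemma ramsey_last_pivot:
  fixes k r L :: nat
  assumes GLR: "\<And>m. \<exists>n. \<forall>c :: 'a::{finite,field} mat \<Rightarrow> nat. (\<forall>A\<in>echelons n k. c A < r) \<longrightarrow>
    (\<exists>R\<in>echelons n m. \<forall>A\<in>echelons m k. \<forall>B\<in>echelons m k. c (R * A) = c (R * B))"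
  shows "\<exists>M. \<forall>c :: 'a mat \<Rightarrow> nat. (\<forall>A\<in>echelons M (Suc k). c A < r) \<longrightarrow> depends_on_head k M M c \<longrightarrow>
    (\<exists>S\<in>echelons M L. \<forall>B B' q q'. echelon L (Suc k) q B \<longrightarrow> echelon L (Suc k) q' B' \<longrightarrow>
       q k = q' k \<longrightarrow> c (S * B) = c (S * B'))"
proof (induction L)
  case 0
  have "\<not> echelon 0 (Suc k) q B" for q and B :: "'a mat"
    using echelon_le by fastforce
  then show ?case using one_mat_in_echelons[of 0] by blast
next
  case (Suc L)
  then obtain M where
    M: "\<forall>c :: 'a mat \<Rightarrow> nat. (\<forall>A\<in>echelons M (Suc k). c A < r) \<longrightarrow> depends_on_head k M M c \<longrightarrow>
    (\<exists>S\<in>echelons M L. \<forall>B B' q q'. echelon L (Suc k) q B \<longrightarrow> echelon L (Suc k) q' B' \<longrightarrow>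
       q k = q' k \<longrightarrow> c (S * B) = c (S * B'))" by (rule exE)
  obtain N where N: "\<forall>c :: 'a mat \<Rightarrow> nat. (\<forall>A\<in>echelons N k. c A < r) \<longrightarrow>
    (\<exists>R\<in>echelons N M. \<forall>A\<in>echelons M k. \<forall>B\<in>echelons M k. c (R * A) = c (R * B))"
    using GLR[of M] by (rule exE)
  show ?case
  proof (intro exI[of _ "Suc N"] allI impI)
    fix c :: "'a mat \<Rightarrow> nat"
    assume c: "\<forall>A\<in>echelons (Suc N) (Suc k). c A < r" and dh: "depends_on_head k (Suc N) (Suc N) c"
    have "\<forall>A\<in>echelons N k. c (ext_mat A) < r" using c ext_mat_echelons by blast
    from N[THEN spec[of _ "\<lambda>A. c (ext_mat A)"], THEN mp, OF this]
    obtain S0 where S0: "S0 \<in> echelons N M"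
      and S0_const: "\<forall>A\<in>echelons M k. \<forall>B\<in>echelons M k. c (ext_mat (S0 * A)) = c (ext_mat (S0 * B))"
      by (elim bexE)
    note S0c = echelons_carrier[OF S0]
    \<comment> \<open>The part of \<open>ext_mat S0\<close> that acts on matrices with zero last
      row; the induction hypothesis is applied to the colouring pulled back along it.\<close>
    define J where "J = ext_mat S0 * sel_mat (Suc M) M id"
    have J: "J \<in> echelons (Suc N) M"
      unfolding J_def using echelons_mult[OF ext_mat_echelons[OF S0] sel_mat_in_echelons] by simp
    have bound: "\<forall>A\<in>echelons M (Suc k). c (J * A) < r" using c echelons_mult[OF J] by blast
    from J obtain pJ where "echelon (Suc N) M pJ J" by (auto simp: echelons_def)
    from M[THEN spec[of _ "\<lambda>B. c (J * B)"], THEN mp, THEN mp, OF bound depends_on_head_mult[OF this dh]]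
    obtain S1 where S1: "S1 \<in> echelons M L"
      and S1_const: "\<forall>B B' q q'. echelon L (Suc k) q B \<longrightarrow> echelon L (Suc k) q' B' \<longrightarrow>
       q k = q' k \<longrightarrow> c (J * (S1 * B)) = c (J * (S1 * B'))"
      by (elim bexE)
    note S1c = echelons_carrier[OF S1]
    \<comment> \<open>\<open>S1\<close> is extended as well, to keep a last row for a pivot. On a
      block sum, \<open>S\<close> then acts as \<open>S0 * S1\<close> on the inner block, and on
      matrices with zero last row it acts as \<open>J * S1\<close>.\<close>
    define S where "S = ext_mat S0 * ext_mat S1"
    have S: "S \<in> echelons (Suc N) (Suc L)"
      unfolding S_def using echelons_mult[OF ext_mat_echelons[OF S0] ext_mat_echelons[OF S1]] .
    have SB: "S * B = ext_mat S0 * (ext_mat S1 * B)" if "B \<in> carrier_mat (Suc L) (Suc k)" for B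
      unfolding S_def using ext_mat_carrier[OF S0c] ext_mat_carrier[OF S1c] that
      by (rule assoc_mult_mat)
    from S obtain pS where pS: "echelon (Suc N) (Suc L) pS S" by (auto simp: echelons_def)
    note dhS = depends_on_head_mult[OF pS dh]
    have low: "c (S * B) = c (J * (S1 * head L B))"
      and low': "echelon L (Suc k) q (head L B)"
      if B: "echelon (Suc L) (Suc k) q B" and q: "q k < L" for B q
    proof -
      let ?h = "head L B" and ?J = "sel_mat (Suc L) L id :: 'a mat"
      show h: "echelon L (Suc k) q ?h" using echelon_head[OF B q] by simp
      note hc = echelonD(1)[OF h]
      have Jc: "?J \<in> carrier_mat (Suc L) L" "sel_mat (Suc M) M id \<in> carrier_mat (Suc M) M"
        by (simp_all add: sel_mat_def)
      have e: "echelon (Suc L) (Suc k) (id \<circ> q) (?J * ?h)"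
        by (rule echelon_mult[OF echelon_sel_mat_id h]) simp
      \<comment> \<open>The last row of \<open>B\<close> is below the last pivot, so zeros may take
        its place.\<close>
      have "c (S * B) = c (S * (?J * ?h))"
      proof (rule depends_on_headD[OF dhS B e])
        show "B $$ (j, l) = (?J * ?h) $$ (j, l)" if "j \<le> q k" "l \<le> k" for j l
        proof -
          have "(?J * ?h) $$ (j, l) = ?h $$ (j, l)"
            using sel_mat_id_mult_entry[OF hc, of "Suc L" j l] that q by simp
          then show ?thesis using that q echelonD(1)[OF B] by (simp add: head_def)
        qed
      qed (use q in auto)
      also have "S * (?J * ?h) = ext_mat S0 * (ext_mat S1 * (?J * ?h))"
        by (rule SB[OF echelonD(1)[OF e]])
      also have "ext_mat S1 * (?J * ?h) = ext_mat S1 * ?J * ?h"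
        by (rule assoc_mult_mat[symmetric, OF ext_mat_carrier[OF S1c] Jc(1) hc])
      also have "\<dots> = sel_mat (Suc M) M id * S1 * ?h" by (simp only: ext_mat_mult_sel_mat[OF S1c])
      also have "\<dots> = sel_mat (Suc M) M id * (S1 * ?h)"
        by (rule assoc_mult_mat[OF Jc(2) S1c hc])
      also have "ext_mat S0 * \<dots> = J * (S1 * ?h)"
        unfolding J_def
        by (rule assoc_mult_mat[symmetric, OF ext_mat_carrier[OF S0c] Jc(2) mult_carrier_mat[OF S1c hc]])
      finally show "c (S * B) = c (J * (S1 * ?h))" .
    qed
    have "c (S * B) = c (S * B')"
      if B: "echelon (Suc L) (Suc k) q B" and B': "echelon (Suc L) (Suc k) q' B'" and q: "q k = q' k"
      for B B' q q'
    proof (cases "q k = L")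
      case True
      obtain X where X: "X \<in> echelons L k" "B = ext_mat X" using echelon_eq_ext_mat[OF B True] by blast
      obtain X' where X': "X' \<in> echelons L k" "B' = ext_mat X'"
        using echelon_eq_ext_mat[OF B'] True q by auto
      have *: "S * ext_mat Z = ext_mat (S0 * (S1 * Z))" if "Z \<in> echelons L k" for Z
      proof -
        note Zc = echelons_carrier[OF that]
        have "S1 * Z \<in> carrier_mat M k" using S1c Zc by simp
        then show ?thesis
          using SB[OF ext_mat_carrier[OF Zc]] ext_mat_mult[OF S1c Zc] ext_mat_mult[OF S0c] by simp
      qed
      show ?thesis
        unfolding X(2) X'(2) *[OF X(1)] *[OF X'(1)]
        using S0_const echelons_mult[OF S1 X(1)] echelons_mult[OF S1 X'(1)] by blast
    next
      case False
      then have "q k < L" "q' k < L" using echelonD(3)[OF B, of k] q by auto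
      then show ?thesis
        using low[OF B] low[OF B'] low'[OF B] low'[OF B'] S1_const q by metis
    qed
    with S show "\<exists>S\<in>echelons (Suc N) (Suc L). \<forall>B B' q q'. echelon (Suc L) (Suc k) q B \<longrightarrow>
      echelon (Suc L) (Suc k) q' B' \<longrightarrow> q k = q' k \<longrightarrow> c (S * B) = c (S * B')" by blast
  qed
qed

theorem ramsey_echelons:
  fixes k m r :: nat
  shows "\<exists>n. \<forall>c :: 'a::{finite,field} mat \<Rightarrow> nat. (\<forall>A\<in>echelons n k. c A < r) \<longrightarrow>
    (\<exists>R\<in>echelons n m. \<forall>A\<in>echelons m k. \<forall>B\<in>echelons m k. c (R * A) = c (R * B))"
proof (induction k arbitrary: m r)
  case 0
  have "A = B" if "A \<in> echelons m 0" "B \<in> echelons m 0" for A B :: "'a mat"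
    using echelons_carrier[OF that(1)] echelons_carrier[OF that(2)] by (intro eq_matI) auto
  then show ?case using one_mat_in_echelons[of m] by metis
next
  case (Suc k)
  \<comment> \<open>Enough pivot positions for \<open>m\<close> of them to share one of the
    \<open>Suc r\<close> values of \<open>g\<close> below.\<close>
  define L where "L = m * Suc r"
  from ramsey_last_pivot[where ?'a = 'a, of k r L, OF Suc.IH] obtain M where
    M: "\<forall>c :: 'a mat \<Rightarrow> nat. (\<forall>A\<in>echelons M (Suc k). c A < r) \<longrightarrow> depends_on_head k M M c \<longrightarrow>
    (\<exists>S\<in>echelons M L. \<forall>B B' q q'. echelon L (Suc k) q B \<longrightarrow> echelon L (Suc k) q' B' \<longrightarrow>
       q k = q' k \<longrightarrow> c (S * B) = c (S * B'))" by (rule exE)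
  \<comment> \<open>With bound \<open>M\<close> on \<open>M\<close> rows, every position of the last
    pivot is covered.\<close>
  from ramsey_depends_on_head_below[where ?'a = 'a, of k r M 0] obtain N where
    N: "\<forall>c :: 'a mat \<Rightarrow> nat. (\<forall>A\<in>echelons N (Suc k). c A < r) \<longrightarrow>
    (\<exists>R\<in>echelons N M. depends_on_head k M M (\<lambda>B. c (R * B)))" unfolding add_0_right by (rule exE)
  show ?case
  proof (intro exI[of _ N] allI impI)
    fix c :: "'a mat \<Rightarrow> nat" assume c: "\<forall>A\<in>echelons N (Suc k). c A < r"
    from N[THEN spec[of _ c], THEN mp, OF c] obtain R where R: "R \<in> echelons N M"
      "depends_on_head k M M (\<lambda>B. c (R * B))" by (rule bexE)
    have "\<forall>A\<in>echelons M (Suc k). c (R * A) < r" using c echelons_mult[OF R(1)] by blast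
    from M[THEN spec[of _ "\<lambda>B. c (R * B)"], THEN mp, THEN mp, OF this R(2)]
    obtain S where S: "S \<in> echelons M L"
      and const: "\<forall>B B' q q'. echelon L (Suc k) q B \<longrightarrow> echelon L (Suc k) q' B' \<longrightarrow>
       q k = q' k \<longrightarrow> c (R * (S * B)) = c (R * (S * B'))" by (rule bexE)
    define P where "P = (\<lambda>l (B :: 'a mat). \<exists>q. echelon L (Suc k) q B \<and> q k = l)"
    \<comment> \<open>The colour as a function of the last pivot position. Positions that no last
      pivot attains get the value 0, which need not be a colour if r = 0; hence the range
      \<open>{..r}\<close> with \<open>Suc r\<close> elements.\<close>
    define g where "g = (\<lambda>l. if \<exists>B. P l B then c (R * (S * (SOME B. P l B))) else 0)"
    have g_eq: "c (R * (S * B)) = g (q k)" if "echelon L (Suc k) q B" for q B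
    proof -
      have "P (q k) B" unfolding P_def using that by blast
      then have ex: "\<exists>B. P (q k) B" by blast
      then have "P (q k) (SOME B. P (q k) B)" by (rule someI_ex)
      then obtain q' where "echelon L (Suc k) q' (SOME B. P (q k) B)" "q' k = q k"
        unfolding P_def by blast
      then have "c (R * (S * B)) = c (R * (S * (SOME B. P (q k) B)))" using const that by metis
      then show ?thesis using ex unfolding g_def by simp
    qed
    have "g l \<in> {..r}" for l
    proof (cases "\<exists>B. P l B")
      case True
      then have "P l (SOME B. P l B)" by (rule someI_ex)
      then have "(SOME B. P l B) \<in> echelons L (Suc k)" unfolding P_def echelons_def by blast
      then have "c (R * (S * (SOME B. P l B))) < r" using c echelons_mult R(1) S by blast
      then show ?thesis using True unfolding g_def by simp
    next
      case False
      then have "g l = 0" unfolding g_def by (rule if_not_P)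
      then show ?thesis by simp
    qed
    then have "g \<in> {..<L} \<rightarrow> {..r}" by auto
    from pigeonhole_card[OF this] obtain y where
      "card (g -` {y} \<inter> {..<L}) * card {..r} \<ge> card {..<L}" by auto
    then have "m * Suc r \<le> card (g -` {y} \<inter> {..<L}) * Suc r" by (simp add: L_def)
    then have "m \<le> card (g -` {y} \<inter> {..<L})" by (simp only: mult_le_cancel2)
    then obtain H where H: "H \<subseteq> g -` {y} \<inter> {..<L}" "card H = m" "finite H"
      by (rule obtain_subset_with_card_n)
    obtain h where h: "bij_betw h {..<card H} H" "strict_mono_on {..<card H} h"
      by (rule ex_bij_betw_strict_mono_card[OF H(3)])
    have hH: "h i \<in> H" if "i < m" for i using bij_betwE[OF h(1)] that H(2) by auto
    \<comment> \<open>Selecting the rows in \<open>H\<close> moves every last pivot into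
      \<open>H\<close>, where \<open>g\<close> is constant.\<close>
    have T: "echelon L m h (sel_mat L m h :: 'a mat)"
      by (rule echelon_sel_mat) (use h(2) H hH in auto)
    let ?R = "R * (S * sel_mat L m h)"
    have "c (?R * A) = y" if A: "A \<in> echelons m (Suc k)" for A
    proof -
      obtain q where q: "echelon m (Suc k) q A" using A by (auto simp: echelons_def)
      have "?R * A = R * (S * sel_mat L m h * A)"
        using echelons_carrier[OF R(1)] echelons_carrier[OF S] echelonD(1)[OF T] echelons_carrier[OF A]
        by (intro assoc_mult_mat) auto
      also have "S * sel_mat L m h * A = S * (sel_mat L m h * A)"
        using echelons_carrier[OF S] echelonD(1)[OF T] echelons_carrier[OF A] by (rule assoc_mult_mat)
      finally have "c (?R * A) = g (h (q k))" using g_eq[OF echelon_mult[OF T q]] by simp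
      moreover have "h (q k) \<in> H" using hH echelonD(3)[OF q, of k] by simp
      ultimately show ?thesis using H(1) by auto
    qed
    moreover have "?R \<in> echelons N m"
      using echelons_mult[OF R(1) echelons_mult[OF S echelonsI[OF T]]] .
    ultimately show "\<exists>R\<in>echelons N m. \<forall>A\<in>echelons m (Suc k). \<forall>B\<in>echelons m (Suc k). c (R * A) = c (R * B)"
      by metis
  qed
qed

section \<open>Families and pairs of echelon matrices\<close>

lemma ramsey_echelons_family:
  fixes k m r :: nat
  assumes U: "finite U"
  shows "\<exists>n. \<forall>c :: 'a::{finite,field} mat \<Rightarrow> 'u \<Rightarrow> nat. (\<forall>A\<in>echelons n k. \<forall>u\<in>U. c A u < r) \<longrightarrow>
    (\<exists>R\<in>echelons n m. \<forall>A\<in>echelons m k. \<forall>B\<in>echelons m k. \<forall>u\<in>U. c (R * A) u = c (R * B) u)"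
proof -
  from encode_colour_family[where r = r and ?'x = "'a mat", OF U]
  obtain r' where r': "\<forall>(F :: 'a mat \<Rightarrow> 'u \<Rightarrow> nat) X. (\<forall>x\<in>X. \<forall>u\<in>U. F x u < r) \<longrightarrow>
    (\<exists>c. (\<forall>x\<in>X. c x < (r'::nat)) \<and>
         (\<forall>x\<in>X. \<forall>y\<in>X. c x = c y \<longrightarrow> (\<forall>u\<in>U. F x u = F y u)))" by (rule exE)
  from ramsey_echelons[where ?'a = 'a, of k r' m] obtain n where
    n: "\<forall>c :: 'a mat \<Rightarrow> nat. (\<forall>A\<in>echelons n k. c A < r') \<longrightarrow>
    (\<exists>R\<in>echelons n m. \<forall>A\<in>echelons m k. \<forall>B\<in>echelons m k. c (R * A) = c (R * B))" by (rule exE)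
  show ?thesis
  proof (intro exI[of _ n] allI impI)
    fix c :: "'a mat \<Rightarrow> 'u \<Rightarrow> nat" assume "\<forall>A\<in>echelons n k. \<forall>u\<in>U. c A u < r"
    from r'[THEN spec[of _ c], THEN spec[of _ "echelons n k"], THEN mp, OF this]
    obtain d where d: "\<forall>A\<in>echelons n k. d A < r'"
      "\<forall>A\<in>echelons n k. \<forall>B\<in>echelons n k. d A = d B \<longrightarrow> (\<forall>u\<in>U. c A u = c B u)"
      by (elim exE conjE)
    from n[THEN spec[of _ d], THEN mp, OF d(1)] obtain R where R: "R \<in> echelons n m"
      "\<forall>A\<in>echelons m k. \<forall>B\<in>echelons m k. d (R * A) = d (R * B)" by (rule bexE)
    have "c (R * A) u = c (R * B) u" if "A \<in> echelons m k" "B \<in> echelons m k" "u \<in> U" for A B u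
    proof -
      have "d (R * A) = d (R * B)" using R(2) that by blast
      then show ?thesis
        using d(2) echelons_mult[OF R(1) that(1)] echelons_mult[OF R(1) that(2)] that(3)
        by (metis (no_types, lifting))
    qed
    then show "\<exists>R\<in>echelons n m. \<forall>A\<in>echelons m k. \<forall>B\<in>echelons m k. \<forall>u\<in>U. c (R * A) u = c (R * B) u"
      using R(1) by blast
  qed
qed

text \<open>The size \<open>n0\<close> for the left factor is fixed first, so the right factor can
  be coloured by the family of colours over the finitely many left factors with \<open>n0\<close>
  rows. Once the right factor no longer matters, the colour is one of the left factor alone.\<close>

lemma ramsey_echelon_pairs:
  fixes k m r :: nat
  assumes U: "finite U"
  shows "\<exists>n. \<forall>c :: 'a::{finite,field} mat \<Rightarrow> 'a mat \<Rightarrow> 'u \<Rightarrow> nat.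
    (\<forall>A\<in>echelons n k. \<forall>B\<in>echelons n k. \<forall>u\<in>U. c A B u < r) \<longrightarrow>
    (\<exists>R0\<in>echelons n m. \<exists>R1\<in>echelons n m. \<forall>A\<in>echelons m k. \<forall>A'\<in>echelons m k.
       \<forall>B\<in>echelons m k. \<forall>B'\<in>echelons m k. \<forall>u\<in>U.
         c (R0 * A) (R1 * B) u = c (R0 * A') (R1 * B') u)"
proof -
  from ramsey_echelons_family[where ?'a = 'a, OF U, of k r m] obtain n0 where
    n0: "\<forall>c :: 'a mat \<Rightarrow> 'u \<Rightarrow> nat. (\<forall>A\<in>echelons n0 k. \<forall>u\<in>U. c A u < r) \<longrightarrow>
    (\<exists>R\<in>echelons n0 m. \<forall>A\<in>echelons m k. \<forall>B\<in>echelons m k. \<forall>u\<in>U. c (R * A) u = c (R * B) u)"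
    by (rule exE)
  let ?V = "(echelons n0 k :: 'a mat set) \<times> U"
  have "(echelons n0 k :: 'a mat set) \<subseteq> carrier_mat n0 k" using echelons_carrier by blast
  then have "finite ?V" using finite_carrier_mat U finite_subset by blast
  \<comment> \<open>Both factors must finally have \<open>n\<close> rows, so \<open>n0\<close> must
    not exceed \<open>n\<close>. Asking for \<open>m + n0\<close> columns ensures this as soon as
    some restriction exists, and with \<open>Suc r\<close> colours the constant colouring 0 is
    admissible even for r = 0 and provides one. \<open>E\<close> later cuts down to \<open>m\<close>
    columns.\<close>
  from ramsey_echelons_family[where ?'a = 'a, OF this, of k "Suc r" "m + n0"] obtain n where
    n: "\<forall>c :: 'a mat \<Rightarrow> 'a mat \<times> 'u \<Rightarrow> nat. (\<forall>A\<in>echelons n k. \<forall>v\<in>?V. c A v < Suc r) \<longrightarrow>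
    (\<exists>R\<in>echelons n (m + n0). \<forall>A\<in>echelons (m + n0) k. \<forall>B\<in>echelons (m + n0) k. \<forall>v\<in>?V.
       c (R * A) v = c (R * B) v)"
    by (rule exE)
  have "\<exists>R :: 'a mat. R \<in> echelons n (m + n0)"
    using n[THEN spec[of _ "\<lambda>_ _. 0"]] by auto
  then have le: "m + n0 \<le> n" unfolding echelons_def using echelon_le by auto
  define J :: "'a mat" where "J = sel_mat n n0 id"
  define E :: "'a mat" where "E = sel_mat (m + n0) m id"
  have J: "J \<in> echelons n n0" unfolding J_def using le by (intro sel_mat_in_echelons) simp
  have E: "E \<in> echelons (m + n0) m" unfolding E_def by (intro sel_mat_in_echelons) simp
  show ?thesis
  proof (intro exI[of _ n] allI impI)
    fix c :: "'a mat \<Rightarrow> 'a mat \<Rightarrow> 'u \<Rightarrow> nat"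
    assume c: "\<forall>A\<in>echelons n k. \<forall>B\<in>echelons n k. \<forall>u\<in>U. c A B u < r"
    have bd: "c (J * A) B u < r" if "A \<in> echelons n0 k" "B \<in> echelons n k" "u \<in> U" for A B u
      using c echelons_mult[OF J that(1)] that(2,3) by blast
    have "\<forall>B\<in>echelons n k. \<forall>v\<in>?V. (\<lambda>B (A, u). c (J * A) B u) B v < Suc r"
      using bd by (auto simp: less_Suc_eq)
    from n[THEN spec[of _ "\<lambda>B (A, u). c (J * A) B u"], THEN mp, OF this]
    obtain R' where R': "R' \<in> echelons n (m + n0)" and
      R'_const: "\<forall>B\<in>echelons (m + n0) k. \<forall>B'\<in>echelons (m + n0) k. \<forall>v\<in>?V.
       (case v of (A, u) \<Rightarrow> c (J * A) (R' * B) u) = (case v of (A, u) \<Rightarrow> c (J * A) (R' * B') u)"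
      by (rule bexE)
    have R1: "R' * E \<in> echelons n m" using echelons_mult[OF R' E] .
    have const1: "c (J * A) (R' * E * B) u = c (J * A) (R' * E * B') u"
      if "A \<in> echelons n0 k" "u \<in> U" "B \<in> echelons m k" "B' \<in> echelons m k" for A u B B'
    proof -
      have as: "R' * E * Z = R' * (E * Z)" if "Z \<in> echelons m k" for Z
        using echelons_carrier[OF R'] echelons_carrier[OF E] echelons_carrier[OF that]
        by (rule assoc_mult_mat)
      have "(A, u) \<in> ?V" using that by blast
      with R'_const echelons_mult[OF E that(3)] echelons_mult[OF E that(4)]
      have "(case (A, u) of (A, u) \<Rightarrow> c (J * A) (R' * (E * B)) u)
        = (case (A, u) of (A, u) \<Rightarrow> c (J * A) (R' * (E * B')) u)" by blast
      then show ?thesis using as that by simp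
    qed
    have "\<exists>S\<in>echelons n0 m. \<forall>A\<in>echelons m k. \<forall>A'\<in>echelons m k. \<forall>B\<in>echelons m k. \<forall>u\<in>U.
      c (J * (S * A)) (R' * E * B) u = c (J * (S * A')) (R' * E * B) u"
    proof -
      define B0 :: "'a mat" where "B0 = (SOME B. B \<in> echelons m k)"
      have B0: "B0 \<in> echelons m k" if "B \<in> echelons m k" for B :: "'a mat"
        unfolding B0_def by (rule someI_ex) (use that in blast)
      \<comment> \<open>The right factor is frozen at \<open>B0\<close>. If there is no such matrix,
        any admissible pair keeps \<open>d\<close> below r, and the claim about
        \<open>echelons m k\<close> is vacuous.\<close>
      define d where "d = (\<lambda>A u. if echelons m k = ({} :: 'a mat set) then c (J * A) (J * A) u
        else c (J * A) (R' * E * B0) u)"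
      have "d A u < r" if "A \<in> echelons n0 k" "u \<in> U" for A u
      proof (cases "echelons m k = ({} :: 'a mat set)")
        case True
        then show ?thesis unfolding d_def using bd[OF that(1) _ that(2)] echelons_mult[OF J that(1)] by simp
      next
        case False
        then have "R' * E * B0 \<in> echelons n k" using B0 echelons_mult[OF R1] by blast
        then show ?thesis unfolding d_def using bd[OF that(1) _ that(2)] False by simp
      qed
      then have "\<forall>A\<in>echelons n0 k. \<forall>u\<in>U. d A u < r" by blast
      from n0[THEN spec[of _ d], THEN mp, OF this] obtain S where S: "S \<in> echelons n0 m"
        "\<forall>A\<in>echelons m k. \<forall>B\<in>echelons m k. \<forall>u\<in>U. d (S * A) u = d (S * B) u" by (rule bexE)
      have "c (J * (S * A)) (R' * E * B) u = c (J * (S * A')) (R' * E * B) u"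
        if "A \<in> echelons m k" "A' \<in> echelons m k" "B \<in> echelons m k" "u \<in> U" for A A' B u
      proof -
        have "d (S * A) u = d (S * A') u" using S(2) that by blast
        moreover have "echelons m k \<noteq> ({} :: 'a mat set)" using that by blast
        ultimately have "c (J * (S * A)) (R' * E * B0) u = c (J * (S * A')) (R' * E * B0) u"
          unfolding d_def by simp
        then show ?thesis
          using const1[OF echelons_mult[OF S(1) that(1)] that(4) that(3) B0[OF that(3)]]
            const1[OF echelons_mult[OF S(1) that(2)] that(4) that(3) B0[OF that(3)]] by simp
      qed
      then show ?thesis using S(1) by blast
    qed
    then obtain S where S: "S \<in> echelons n0 m" and
      const0: "\<forall>A\<in>echelons m k. \<forall>A'\<in>echelons m k. \<forall>B\<in>echelons m k. \<forall>u\<in>U.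
      c (J * (S * A)) (R' * E * B) u = c (J * (S * A')) (R' * E * B) u" by (rule bexE)
    have "c (J * S * A) (R' * E * B) u = c (J * S * A') (R' * E * B') u"
      if "A \<in> echelons m k" "A' \<in> echelons m k" "B \<in> echelons m k" "B' \<in> echelons m k" "u \<in> U"
      for A A' B B' u
    proof -
      have as: "J * S * Z = J * (S * Z)" if "Z \<in> echelons m k" for Z
        using echelons_carrier[OF J] echelons_carrier[OF S] echelons_carrier[OF that]
        by (rule assoc_mult_mat)
      have "c (J * (S * A)) (R' * E * B) u = c (J * (S * A')) (R' * E * B) u"
        using const0 that by blast
      also have "\<dots> = c (J * (S * A')) (R' * E * B') u"
        using const1[OF echelons_mult[OF S that(2)] that(5) that(3,4)] .
      finally show ?thesis using as that by simp
    qed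
    then show "\<exists>R0\<in>echelons n m. \<exists>R1\<in>echelons n m. \<forall>A\<in>echelons m k. \<forall>A'\<in>echelons m k.
       \<forall>B\<in>echelons m k. \<forall>B'\<in>echelons m k. \<forall>u\<in>U.
         c (R0 * A) (R1 * B) u = c (R0 * A') (R1 * B') u"
      using echelons_mult[OF J S] R1 by blast
  qed
qed

section \<open>Rank and the two-sided echelon decomposition\<close>

text \<open>Each matrix is a right multiple of the other, so the column spaces agree.\<close>

lemma mrank_eq:
  assumes A: "A \<in> carrier_mat n m" and X: "X \<in> carrier_mat n k"
    and Y: "Y \<in> carrier_mat k m" and Z: "Z \<in> carrier_mat m k"
    and eq: "A = X * Y" "X = A * Z"
  shows "mrank A = mrank X"
proof -
  interpret vec_space "TYPE('a)" n .
  have "col_space A = col_space X"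
  proof (intro equalityI subsetI)
    fix v assume "v \<in> col_space A"
    then obtain x where x: "x \<in> carrier_vec m" "A *\<^sub>v x = v" "v \<in> carrier_vec n"
      unfolding col_space_eq[OF A] using A by auto
    have "X *\<^sub>v (Y *\<^sub>v x) = v" using x eq(1) assoc_mult_mat_vec[OF X Y x(1)] by simp
    then show "v \<in> col_space X" unfolding col_space_eq[OF X] using X Y x by auto
  next
    fix v assume "v \<in> col_space X"
    then obtain x where x: "x \<in> carrier_vec k" "X *\<^sub>v x = v" "v \<in> carrier_vec n"
      unfolding col_space_eq[OF X] using X by auto
    have "A *\<^sub>v (Z *\<^sub>v x) = v" using x eq(2) assoc_mult_mat_vec[OF A Z x(1)] by simp
    then show "v \<in> col_space A" unfolding col_space_eq[OF A] using A Z x by auto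
  qed
  then have "rank A = rank X" unfolding rank_def col_space_def by simp
  then show ?thesis unfolding mrank_def using A X by simp
qed

lemma mrank_le: "A \<in> carrier_mat n m \<Longrightarrow> mrank A \<le> m"
  unfolding mrank_def using vec_space.rank_le_nc[of A n m] by simp

lemma echelon_left_inverse:
  assumes A: "echelon n k p A"
  shows "\<exists>L\<in>carrier_mat k n. L * A = 1\<^sub>m k"
proof
  let ?L = "(sel_mat n k p)\<^sup>T :: 'a mat"
  show L: "?L \<in> carrier_mat k n" by (simp add: sel_mat_def)
  show "?L * A = 1\<^sub>m k"
  proof (rule eq_matI)
    fix i j assume "i < dim_row (1\<^sub>m k :: 'a mat)" "j < dim_col (1\<^sub>m k :: 'a mat)"
    then have i: "i < k" and j: "j < k" by auto
    have "(?L * A) $$ (i, j) = A $$ (p i, j)"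
      by (rule mult_unit_row[OF L echelonD(1)[OF A] i j echelonD(3)[OF A i]])
        (use i in \<open>auto simp: sel_mat_def\<close>)
    then show "(?L * A) $$ (i, j) = 1\<^sub>m k $$ (i, j)" using echelonD(4)[OF A i j] i j by auto
  qed (use L echelonD(1)[OF A] in auto)
qed

lemma mrank_one: "mrank (1\<^sub>m n :: 'a::field mat) = n"
proof -
  have "vec_space.rank n (1\<^sub>m n :: 'a mat) = n"
    using vec_space.low_rank_det_zero[of "1\<^sub>m n :: 'a mat" n] by simp
  then show ?thesis by (simp add: mrank_def)
qed

lemma mrank_echelon:
  assumes A: "echelon n k p A"
  shows "mrank A = k"
proof -
  interpret vec_space "TYPE('a)" n .
  note A1 = echelonD(1)[OF A]
  obtain L where L: "L \<in> carrier_mat k n" "L * A = 1\<^sub>m k" using echelon_left_inverse[OF A] by blast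
  \<comment> \<open>The columns enter linear independence as a set, so repetitions have to be
    excluded before the left inverse is used.\<close>
  have "distinct (cols A)"
  proof -
    have "col A i \<noteq> col A j" if "i < k" "j < k" "i \<noteq> j" for i j
    proof
      assume "col A i = col A j"
      then have "col A i $ p i = col A j $ p i" by simp
      then show False using that echelonD(3,4)[OF A, of i] A1 by auto
    qed
    then show ?thesis using A1 by (auto simp: distinct_conv_nth)
  qed
  moreover have "lin_indpt (set (cols A))"
  proof
    assume "lin_dep (set (cols A))"
    then obtain v where v: "v \<in> carrier_vec k" "v \<noteq> 0\<^sub>v k" "A *\<^sub>v v = 0\<^sub>v n"
      using lin_depE[OF A1 _ \<open>distinct (cols A)\<close>] by blast
    have "L *\<^sub>v (A *\<^sub>v v) = v" using assoc_mult_mat_vec[OF L(1) A1 v(1)] L(2) v(1) by simp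
    then show False using v L(1) by auto
  qed
  ultimately have "rank A = k" using lin_indpt_full_rank[OF A1] by blast
  then show ?thesis using A1 by (simp add: mrank_def)
qed

lemma invertible_mat_iff:
  assumes "T \<in> carrier_mat k k"
  shows "invertible_mat T \<longleftrightarrow> (\<exists>S\<in>carrier_mat k k. T * S = 1\<^sub>m k \<and> S * T = 1\<^sub>m k)"
proof
  assume "invertible_mat T"
  then obtain S where S: "T * S = 1\<^sub>m k" "S * T = 1\<^sub>m (dim_row S)"
    using assms unfolding invertible_mat_def inverts_mat_def by auto
  have "dim_col S = k" using S(1) by (metis index_mult_mat(3) index_one_mat(3))
  moreover have "dim_row S = k" using S(2) assms by (metis carrier_matD(2) index_mult_mat(3) index_one_mat(3))
  ultimately show "\<exists>S\<in>carrier_mat k k. T * S = 1\<^sub>m k \<and> S * T = 1\<^sub>m k" using S by (intro bexI[of _ S]) auto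
next
  assume "\<exists>S\<in>carrier_mat k k. T * S = 1\<^sub>m k \<and> S * T = 1\<^sub>m k"
  then show "invertible_mat T" using assms unfolding invertible_mat_def inverts_mat_def by auto
qed

section \<open>Existence of the two-sided decomposition\<close>

text \<open>\<open>pivot_fun\<close> assigns \<open>n\<close> to zero rows, and these come last. So
  r is the number of nonzero rows; transposed, they are the columns of an echelon matrix, and the
  second factor pads it with zero columns.\<close>

lemma pivot_fun_echelon:
  assumes C: "C \<in> carrier_mat m n" and f: "pivot_fun C f n"
  shows "\<exists>r A0. echelon n r f A0 \<and> r \<le> m \<and> C\<^sup>T = A0 * (sel_mat m r id)\<^sup>T"
proof -
  have f1: "f i \<le> n" "f i < n \<Longrightarrow> C $$ (i, f i) = 1"
    "f i < n \<Longrightarrow> i' < m \<Longrightarrow> i' \<noteq> i \<Longrightarrow> C $$ (i', f i) = 0"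
    "j < f i \<Longrightarrow> C $$ (i, j) = 0"
    "Suc i < m \<Longrightarrow> f (Suc i) > f i \<or> f (Suc i) = n" if "i < m" for i i' j
    using f that C unfolding pivot_fun_def by (auto simp: Let_def)
  define r where "r = (LEAST r. r = m \<or> f r = n)"
  have r: "r = m \<or> f r = n" unfolding r_def by (rule LeastI[of _ m]) simp
  have rm: "r \<le> m" unfolding r_def by (rule Least_le) simp
  have below: "f i < n" if "i < r" for i
  proof -
    have "\<not> (i = m \<or> f i = n)" using that not_less_Least unfolding r_def by blast
    then show ?thesis using f1(1)[of i] that rm by simp
  qed
  have above: "i < m \<Longrightarrow> f i = n" if "r \<le> i" for i
    using that
  proof (induction i rule: dec_induct)
    case base
    then show ?case using r by simp
  next
    case (step i)
    then show ?case using f1(5)[of i] f1(1)[of "Suc i"] by simp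
  qed
  have inc: "f i < f i'" if "i < i'" "i' < r" for i i'
    using that
  proof (induction i')
    case (Suc a)
    have "f a < f (Suc a)" using f1(5)[of a] below[of "Suc a"] Suc.prems rm by auto
    then show ?case using Suc by (cases "i = a") auto
  qed simp
  define A0 where "A0 = mat n r (\<lambda>(i, j). C $$ (j, i))"
  have "echelon n r f A0"
    unfolding echelon_def
  proof (intro conjI allI impI)
    show "A0 \<in> carrier_mat n r" by (simp add: A0_def)
    show "A0 $$ (f i, l) = (if l = i then 1 else 0)" if "i < r" "l < r" for i l
      using that below[of i] f1(2,3)[of i] rm by (auto simp: A0_def)
    show "A0 $$ (j, i) = 0" if "i < r" "j < f i" for i j
      using that below[of i] f1(4)[of i j] rm by (auto simp: A0_def)
  qed (use inc below in auto)
  moreover have "C\<^sup>T = A0 * (sel_mat m r id)\<^sup>T"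
  proof (rule eq_matI)
    have c: "A0 \<in> carrier_mat n r" "(sel_mat m r id)\<^sup>T \<in> carrier_mat r m"
      by (simp_all add: A0_def sel_mat_def)
    fix i j assume "i < dim_row (A0 * (sel_mat m r id)\<^sup>T)" "j < dim_col (A0 * (sel_mat m r id)\<^sup>T)"
    then have i: "i < n" and j: "j < m" by (auto simp: A0_def sel_mat_def)
    have "(A0 * (sel_mat m r id)\<^sup>T) $$ (i, j) = (\<Sum>t<r. if t = j then A0 $$ (i, t) else 0)"
      unfolding mult_mat_entry[OF c i j] using j by (intro sum.cong) (auto simp: sel_mat_def)
    also have "\<dots> = (if j < r then A0 $$ (i, j) else 0)" by simp
    also have "\<dots> = C $$ (j, i)" using above[of j] f1(4)[of j i] i j by (auto simp: A0_def)
    finally show "C\<^sup>T $$ (i, j) = (A0 * (sel_mat m r id)\<^sup>T) $$ (i, j)" using C i j by simp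
  qed (use C in \<open>auto simp: A0_def sel_mat_def\<close>)
  ultimately show ?thesis using rm by blast
qed

text \<open>Gauss-Jordan elimination of the transpose. With \<open>P\<close> the transformation and
  \<open>Q\<close> its inverse, \<open>B\<close> consists of the first r rows of
  \<open>Q\<^sup>T\<close>, and \<open>Z\<close> of the first r columns of
  \<open>P\<^sup>T\<close>.\<close>

lemma echelon_factor:
  fixes A :: "'a::field mat"
  assumes A: "A \<in> carrier_mat n m"
  shows "\<exists>r. \<exists>A0\<in>echelons n r. \<exists>B\<in>carrier_mat r m. \<exists>Z\<in>carrier_mat m r. A = A0 * B \<and> B * Z = 1\<^sub>m r"
proof -
  have At: "A\<^sup>T \<in> carrier_mat m n" using A by simp
  obtain C D where gj: "gauss_jordan (A\<^sup>T) (1\<^sub>m m) = (C, D)" by (cases "gauss_jordan (A\<^sup>T) (1\<^sub>m m)")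
  have one: "(1\<^sub>m m :: 'a mat) \<in> carrier_mat m m" by simp
  have C: "C \<in> carrier_mat m n" using gauss_jordan_carrier[OF At one gj] by simp
  obtain P where P: "P \<in> Units (ring_mat TYPE('a) m ())" and CP: "C = P * A\<^sup>T"
    using gauss_jordan_transform[OF At one gj, of "()"] by blast
  then obtain Q where PQ: "P \<in> carrier_mat m m" "Q \<in> carrier_mat m m" "Q * P = 1\<^sub>m m"
    unfolding Units_def ring_mat_def by auto
  have QP: "P * Q = 1\<^sub>m m" using mat_mult_left_right_inverse[OF PQ(2,1,3)] .
  obtain f where "pivot_fun C f n"
    using gauss_jordan_row_echelon[OF At gj] C unfolding row_echelon_form_def by auto
  from pivot_fun_echelon[OF C this] obtain r A0 where A0: "echelon n r f A0" and rm: "r \<le> m"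
    and CA: "C\<^sup>T = A0 * (sel_mat m r id)\<^sup>T" by blast
  note A0c = echelonD(1)[OF A0]
  let ?J = "sel_mat m r id :: 'a mat"
  have J: "?J \<in> carrier_mat m r" by (simp add: sel_mat_def)
  have t: "?J\<^sup>T \<in> carrier_mat r m" "Q\<^sup>T \<in> carrier_mat m m" "P\<^sup>T \<in> carrier_mat m m"
    using J PQ by auto
  have "A\<^sup>T = Q * C"
    unfolding CP using assoc_mult_mat[OF PQ(2,1) At] PQ(3) left_mult_one_mat[OF At] by simp
  then have "A = C\<^sup>T * Q\<^sup>T" using transpose_mult[OF PQ(2) C] by (metis Matrix.transpose_transpose)
  then have "A = A0 * (?J\<^sup>T * Q\<^sup>T)"
    unfolding CA assoc_mult_mat[OF A0c t(1,2)] .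
  moreover have "?J\<^sup>T * Q\<^sup>T * (P\<^sup>T * ?J) = 1\<^sub>m r"
  proof -
    have JJ: "?J\<^sup>T * ?J = 1\<^sub>m r"
    proof (rule eq_matI)
      fix i j assume "i < dim_row (1\<^sub>m r :: 'a mat)" "j < dim_col (1\<^sub>m r :: 'a mat)"
      then have i: "i < r" and j: "j < r" by auto
      have "(?J\<^sup>T * ?J) $$ (i, j) = ?J $$ (i, j)"
        by (rule mult_unit_row[of _ r m _ r]) (use i j rm in \<open>auto simp: sel_mat_def\<close>)
      then show "(?J\<^sup>T * ?J) $$ (i, j) = 1\<^sub>m r $$ (i, j)" using i j rm by (auto simp: sel_mat_def)
    qed (use J in auto)
    have "Q\<^sup>T * P\<^sup>T = 1\<^sub>m m" using transpose_mult[OF PQ(1,2)] QP by simp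
    then have "Q\<^sup>T * (P\<^sup>T * ?J) = ?J"
      using assoc_mult_mat[OF t(2,3) J] left_mult_one_mat[OF J] by simp
    then have "?J\<^sup>T * (Q\<^sup>T * (P\<^sup>T * ?J)) = 1\<^sub>m r" using JJ by simp
    then show ?thesis
      unfolding assoc_mult_mat[OF t(1,2) mult_carrier_mat[OF t(3) J]] .
  qed
  ultimately show ?thesis
    using echelonsI[OF A0] PQ J
    by (intro exI[of _ r] bexI[of _ A0] bexI[of _ "?J\<^sup>T * Q\<^sup>T"] bexI[of _ "P\<^sup>T * ?J"]) auto
qed

text \<open>A product equal to the identity of size b that passes through dimension a forces b to be
  at most a, by rank. The two one-sided inverses give both inequalities.\<close>

lemma two_sided_inverse_square:
  fixes T :: "'a::field mat"
  assumes T: "T \<in> carrier_mat r s" and L: "L \<in> carrier_mat s r" "L * T = 1\<^sub>m s"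
    and R: "R \<in> carrier_mat s r" "T * R = 1\<^sub>m r"
  shows "r = s" "L = R"
proof -
  have le: "b \<le> a" if "X \<in> carrier_mat a b" "Y \<in> carrier_mat b a" "Y * X = 1\<^sub>m b"
    for a b and X Y :: "'a mat"
  proof -
    have "mrank Y = mrank (1\<^sub>m b :: 'a mat)"
      by (rule mrank_eq[of _ b a _ b Y X]) (use that in auto)
    then show ?thesis using mrank_le[OF that(2)] mrank_one[of b, where ?'a = 'a] by simp
  qed
  show "r = s" using le[OF T L] le[OF R(1) T R(2)] by simp
  have "L = L * (T * R)" using L R by simp
  also have "\<dots> = L * T * R" using assoc_mult_mat[OF L(1) T R(1)] by simp
  finally show "L = R" using L R by simp
qed

text \<open>Factor \<open>A\<close>, then the transpose of its right factor \<open>B\<close>. The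
  remaining middle matrix \<open>D\<^sup>T\<close> has a left inverse from the second factorization
  and a right inverse from the right inverse \<open>Z\<close> of \<open>B\<close>, so it is square
  and invertible.\<close>

lemma echelon_decomposition_exists:
  fixes A :: "'a::field mat"
  assumes A: "A \<in> carrier_mat n m"
  shows "\<exists>r. \<exists>A0\<in>echelons n r. \<exists>A1\<in>echelons m r. \<exists>T\<in>carrier_mat r r.
    invertible_mat T \<and> A = A0 * T * A1\<^sup>T"
proof -
  obtain r A0 B Z where A0: "A0 \<in> echelons n r" and B: "B \<in> carrier_mat r m"
    and Z: "Z \<in> carrier_mat m r" and AB: "A = A0 * B" and BZ: "B * Z = 1\<^sub>m r"
    using echelon_factor[OF A] by blast
  have Bt: "B\<^sup>T \<in> carrier_mat m r" using B by simp
  obtain s A1 D W where A1: "A1 \<in> echelons m s" and D: "D \<in> carrier_mat s r"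
    and W: "W \<in> carrier_mat r s" and BD: "B\<^sup>T = A1 * D" and DW: "D * W = 1\<^sub>m s"
    using echelon_factor[OF Bt] by blast
  note A0c = echelons_carrier[OF A0] and A1c = echelons_carrier[OF A1]
  have BT: "B = D\<^sup>T * A1\<^sup>T" using BD transpose_mult[OF A1c D] by (metis Matrix.transpose_transpose)
  have Dt: "D\<^sup>T \<in> carrier_mat r s" and Wt: "W\<^sup>T \<in> carrier_mat s r" using D W by auto
  have WD: "W\<^sup>T * D\<^sup>T = 1\<^sub>m s" using transpose_mult[OF D W] DW by simp
  have A1t: "A1\<^sup>T \<in> carrier_mat s m" using A1c by simp
  have AZ: "A1\<^sup>T * Z \<in> carrier_mat s r" using A1c Z by simp
  have DZ: "D\<^sup>T * (A1\<^sup>T * Z) = 1\<^sub>m r"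
    using assoc_mult_mat[OF Dt A1t Z] BT BZ by simp
  have rs: "r = s" and inv: "W\<^sup>T = A1\<^sup>T * Z"
    using two_sided_inverse_square[OF Dt Wt WD AZ DZ] by auto
  have "invertible_mat (D\<^sup>T)"
    using invertible_mat_iff[of "D\<^sup>T" r] Dt Wt WD DZ inv rs by auto
  moreover have "A = A0 * D\<^sup>T * A1\<^sup>T"
    unfolding AB BT using assoc_mult_mat[OF A0c Dt A1t] by simp
  ultimately show ?thesis
    using A0 A1 Dt rs by (intro exI[of _ r] bexI[of _ A0] bexI[of _ A1] bexI[of _ "D\<^sup>T"]) auto
qed

text \<open>\<open>T * A1\<^sup>T\<close> has a right inverse, so the product has the same column
  space as \<open>A0\<close>.\<close>

lemma mrank_decomposition:
  assumes A0: "A0 \<in> echelons n r" and A1: "A1 \<in> echelons m r"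
    and T: "T \<in> carrier_mat r r" "invertible_mat T"
  shows "mrank (A0 * T * A1\<^sup>T) = r"
proof -
  note A0c = echelons_carrier[OF A0] and A1c = echelons_carrier[OF A1]
  have A1t: "A1\<^sup>T \<in> carrier_mat r m" using A1c by simp
  obtain S where S: "S \<in> carrier_mat r r" "T * S = 1\<^sub>m r" using invertible_mat_iff[OF T(1)] T(2) by blast
  obtain L where L: "L \<in> carrier_mat r m" "L * A1 = 1\<^sub>m r"
    using A1 echelon_left_inverse unfolding echelons_def by blast
  have Lt: "L\<^sup>T \<in> carrier_mat m r" using L by simp
  have AL: "A1\<^sup>T * L\<^sup>T = 1\<^sub>m r" using transpose_mult[OF L(1) A1c] L(2) by simp
  have AT: "A0 * T \<in> carrier_mat n r" using A0c T by simp
  have "A0 * T * A1\<^sup>T * (L\<^sup>T * S) = A0 * T * (A1\<^sup>T * (L\<^sup>T * S))"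
    by (rule assoc_mult_mat[OF AT A1t mult_carrier_mat[OF Lt S(1)]])
  also have "A1\<^sup>T * (L\<^sup>T * S) = S"
    using assoc_mult_mat[OF A1t Lt S(1)] AL S(1) by simp
  also have "A0 * T * S = A0" using assoc_mult_mat[OF A0c T(1) S(1)] S(2) A0c by simp
  finally have e: "A0 = A0 * T * A1\<^sup>T * (L\<^sup>T * S)" by simp
  have "mrank (A0 * T * A1\<^sup>T) = mrank A0"
    by (rule mrank_eq[where X = A0 and Y = "T * A1\<^sup>T" and Z = "L\<^sup>T * S"])
       (use e A0c T A1t Lt S assoc_mult_mat[OF A0c T(1) A1t] in auto)
  also have "\<dots> = r" using A0 mrank_echelon unfolding echelons_def by blast
  finally show ?thesis .
qed

section \<open>Uniqueness of the decomposition\<close>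

text \<open>At the first index i where the pivots differ, say with \<open>p i < q i\<close>, row
  \<open>p i\<close> of \<open>B\<close> lives on the columns before i. The coefficients of column i
  of \<open>A\<close> at those columns are entries of \<open>A\<close> at earlier pivots, hence
  zero, against the pivot entry 1. Once the pivots agree, comparing the pivot rows yields that
  \<open>G\<close> is the identity.\<close>

lemma echelon_unique:
  fixes A B :: "'a::field mat"
  assumes A: "echelon n k p A" and B: "echelon n k q B"
    and G: "G \<in> carrier_mat k k" "A = B * G" and H: "H \<in> carrier_mat k k" "B = A * H"
  shows "A = B"
proof -
  have no_less: "\<not> p i < q i"
    if A: "echelon n k p A" and B: "echelon n k q B" and G: "G \<in> carrier_mat k k" "A = B * G"
      and i: "i < k" "\<forall>l<i. p l = q l" for p q and A B G :: "'a mat" and i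
  proof
    assume lt: "p i < q i"
    have "A $$ (p i, i) = (\<Sum>l<k. B $$ (p i, l) * G $$ (l, i))"
      unfolding G(2) by (rule mult_mat_entry[OF echelonD(1)[OF B] G(1) echelonD(3)[OF A i(1)] i(1)])
    also have "\<dots> = 0"
    proof (intro sum.neutral ballI)
      fix l assume "l \<in> {..<k}"
      then have l: "l < k" by simp
      show "B $$ (p i, l) * G $$ (l, i) = 0"
      proof (cases "l < i")
        case True
        have "A $$ (q l, i) = G $$ (l, i)"
          unfolding G(2)
          by (rule mult_unit_row[OF echelonD(1)[OF B] G(1) echelonD(3)[OF B l] i(1) l echelonD(4)[OF B l]])
        moreover have "A $$ (q l, i) = 0" using echelonD(4)[OF A l i(1)] True i(2) by simp
        ultimately show ?thesis by simp
      next
        case False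
        then have "p i < q l" using lt echelon_pivot_mono[OF B _ l, of i] by simp
        then show ?thesis using echelonD(5)[OF B l] by simp
      qed
    qed
    finally show False using echelonD(4)[OF A i(1) i(1)] by simp
  qed
  have pq: "i < k \<Longrightarrow> p i = q i" for i
  proof (induction i rule: less_induct)
    case (less i)
    then have "\<forall>l<i. p l = q l" "\<forall>l<i. q l = p l" by auto
    then show ?case using no_less[OF A B G less.prems] no_less[OF B A H less.prems] by simp
  qed
  have "G = 1\<^sub>m k"
  proof (rule eq_matI)
    fix l i assume "l < dim_row (1\<^sub>m k :: 'a mat)" "i < dim_col (1\<^sub>m k :: 'a mat)"
    then have l: "l < k" and i: "i < k" by auto
    have "A $$ (q l, i) = G $$ (l, i)"
      unfolding G(2)
      by (rule mult_unit_row[OF echelonD(1)[OF B] G(1) echelonD(3)[OF B l] i l echelonD(4)[OF B l]])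
    then show "G $$ (l, i) = 1\<^sub>m k $$ (l, i)" using echelonD(4)[OF A l i] pq[OF l] l i by auto
  qed (use G in auto)
  then show ?thesis using G(2) echelonD(1)[OF B] by simp
qed

text \<open>Cancelling \<open>T * A1\<^sup>T\<close> by a right inverse writes \<open>A0\<close> as
  a right multiple of \<open>B0\<close>, and conversely, so \<open>echelon_unique\<close>
  applies.\<close>

lemma decomposition_left_unique:
  fixes A0 B0 :: "'a::field mat"
  assumes "A0 \<in> echelons n r" "A1 \<in> echelons m r" "T \<in> carrier_mat r r" "invertible_mat T"
    and "B0 \<in> echelons n r" "B1 \<in> echelons m r" "S \<in> carrier_mat r r" "invertible_mat S"
    and "A0 * T * A1\<^sup>T = B0 * S * B1\<^sup>T"
  shows "A0 = B0"
proof -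
  have factor: "\<exists>G\<in>carrier_mat r r. A0 = B0 * G"
    if A0: "A0 \<in> echelons n r" and A1: "A1 \<in> echelons m r" and T: "T \<in> carrier_mat r r" "invertible_mat T"
      and B0: "B0 \<in> echelons n r" and B1: "B1 \<in> echelons m r" and S: "S \<in> carrier_mat r r"
      and eq: "A0 * T * A1\<^sup>T = B0 * S * B1\<^sup>T" for A0 B0 A1 B1 S T :: "'a mat"
  proof -
    note A0c = echelons_carrier[OF A0] and A1c = echelons_carrier[OF A1]
      and B0c = echelons_carrier[OF B0] and B1c = echelons_carrier[OF B1]
    have A1t: "A1\<^sup>T \<in> carrier_mat r m" "B1\<^sup>T \<in> carrier_mat r m" using A1c B1c by auto
    obtain T' where T': "T' \<in> carrier_mat r r" "T * T' = 1\<^sub>m r"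
      using invertible_mat_iff[OF T(1)] T(2) by blast
    obtain L where L: "L \<in> carrier_mat r m" "L * A1 = 1\<^sub>m r"
      using A1 echelon_left_inverse unfolding echelons_def by blast
    have Lt: "L\<^sup>T \<in> carrier_mat m r" using L by simp
    have AL: "A1\<^sup>T * L\<^sup>T = 1\<^sub>m r" using transpose_mult[OF L(1) A1c] L(2) by simp
    have LT: "L\<^sup>T * T' \<in> carrier_mat m r" using Lt T' by simp
    have AT: "A0 * T \<in> carrier_mat n r" "B0 * S \<in> carrier_mat n r" using A0c B0c T S by auto
    have "A0 * T * A1\<^sup>T * (L\<^sup>T * T') = A0 * T * (A1\<^sup>T * (L\<^sup>T * T'))"
      by (rule assoc_mult_mat[OF AT(1) A1t(1) LT])
    also have "A1\<^sup>T * (L\<^sup>T * T') = T'"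
      using assoc_mult_mat[OF A1t(1) Lt T'(1)] AL T'(1) by simp
    also have "A0 * T * T' = A0" using assoc_mult_mat[OF A0c T(1) T'(1)] T'(2) A0c by simp
    finally have "A0 = B0 * S * B1\<^sup>T * (L\<^sup>T * T')" using eq by simp
    also have "\<dots> = B0 * S * (B1\<^sup>T * (L\<^sup>T * T'))" by (rule assoc_mult_mat[OF AT(2) A1t(2) LT])
    also have "\<dots> = B0 * (S * (B1\<^sup>T * (L\<^sup>T * T')))"
      by (rule assoc_mult_mat[OF B0c S mult_carrier_mat[OF A1t(2) LT]])
    finally have "A0 = B0 * (S * (B1\<^sup>T * (L\<^sup>T * T')))" .
    moreover have "S * (B1\<^sup>T * (L\<^sup>T * T')) \<in> carrier_mat r r"
      using S A1t(2) LT by simp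
    ultimately show ?thesis by blast
  qed
  obtain G where G: "G \<in> carrier_mat r r" "A0 = B0 * G"
    using factor[OF assms(1-7,9)] by blast
  obtain H where H: "H \<in> carrier_mat r r" "B0 = A0 * H"
    using factor[OF assms(5-8) assms(1-3) assms(9)[symmetric]] by blast
  show ?thesis using assms(1,5) echelon_unique[OF _ _ G H] unfolding echelons_def by blast
qed

text \<open>Transposition exchanges the outer factors, so the right ones agree as well; one-sided
  inverses of the outer factors then isolate the middle.\<close>

lemma decomposition_unique:
  fixes A0 B0 :: "'a::field mat"
  assumes A0: "A0 \<in> echelons n r" and A1: "A1 \<in> echelons m r"
    and T: "T \<in> carrier_mat r r" "invertible_mat T"
    and B0: "B0 \<in> echelons n r" and B1: "B1 \<in> echelons m r"
    and S: "S \<in> carrier_mat r r" "invertible_mat S"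
    and eq: "A0 * T * A1\<^sup>T = B0 * S * B1\<^sup>T"
  shows "T = S"
proof -
  note A0c = echelons_carrier[OF A0] and A1c = echelons_carrier[OF A1]
    and B0c = echelons_carrier[OF B0] and B1c = echelons_carrier[OF B1]
  have tr: "(X0 * U * X1\<^sup>T)\<^sup>T = X1 * U\<^sup>T * X0\<^sup>T"
    if "X0 \<in> carrier_mat n r" "X1 \<in> carrier_mat m r" "U \<in> carrier_mat r r" for X0 X1 U :: "'a mat"
  proof -
    have t: "X1\<^sup>T \<in> carrier_mat r m" "U\<^sup>T \<in> carrier_mat r r" "X0\<^sup>T \<in> carrier_mat r n" using that by auto
    have "(X0 * U * X1\<^sup>T)\<^sup>T = X1 * (X0 * U)\<^sup>T"
      using transpose_mult[OF mult_carrier_mat[OF that(1,3)] t(1)] by simp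
    also have "(X0 * U)\<^sup>T = U\<^sup>T * X0\<^sup>T" by (rule transpose_mult[OF that(1,3)])
    also have "X1 * (U\<^sup>T * X0\<^sup>T) = X1 * U\<^sup>T * X0\<^sup>T"
      by (rule assoc_mult_mat[symmetric, OF that(2) t(2,3)])
    finally show ?thesis .
  qed
  have inv: "invertible_mat (U\<^sup>T)" if U: "U \<in> carrier_mat r r" "invertible_mat U" for U :: "'a mat"
  proof -
    obtain V where V: "V \<in> carrier_mat r r" "U * V = 1\<^sub>m r" "V * U = 1\<^sub>m r"
      using invertible_mat_iff[OF U(1)] U(2) by blast
    have "U\<^sup>T * V\<^sup>T = 1\<^sub>m r" "V\<^sup>T * U\<^sup>T = 1\<^sub>m r"
      unfolding transpose_mult[OF U(1) V(1), symmetric] transpose_mult[OF V(1) U(1), symmetric] V(2,3)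
      by simp_all
    then show ?thesis using invertible_mat_iff[of "U\<^sup>T" r] U(1) V(1) by auto
  qed
  have e0: "A0 = B0" using decomposition_left_unique[OF A0 A1 T B0 B1 S eq] .
  have eqt: "A1 * T\<^sup>T * A0\<^sup>T = B1 * S\<^sup>T * B0\<^sup>T"
    using tr[OF A0c A1c T(1)] tr[OF B0c B1c S(1)] eq by simp
  have e1: "A1 = B1"
    by (rule decomposition_left_unique[OF A1 A0 _ inv[OF T] B1 B0 _ inv[OF S] eqt]) (use T S in auto)
  obtain L0 where L0: "L0 \<in> carrier_mat r n" "L0 * A0 = 1\<^sub>m r"
    using A0 echelon_left_inverse unfolding echelons_def by blast
  obtain L1 where L1: "L1 \<in> carrier_mat r m" "L1 * A1 = 1\<^sub>m r"
    using A1 echelon_left_inverse unfolding echelons_def by blast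
  have L1t: "L1\<^sup>T \<in> carrier_mat m r" "A1\<^sup>T \<in> carrier_mat r m" using L1 A1c by auto
  have AL: "A1\<^sup>T * L1\<^sup>T = 1\<^sub>m r" using transpose_mult[OF L1(1) A1c] L1(2) by simp
  have cancel: "L0 * ((A0 * U * A1\<^sup>T) * L1\<^sup>T) = U" if U: "U \<in> carrier_mat r r" for U
  proof -
    have AU: "A0 * U \<in> carrier_mat n r" using A0c U by simp
    have "A0 * U * A1\<^sup>T * L1\<^sup>T = A0 * U * (A1\<^sup>T * L1\<^sup>T)"
      by (rule assoc_mult_mat[OF AU L1t(2,1)])
    also have "\<dots> = A0 * U" unfolding AL by (rule right_mult_one_mat[OF AU])
    finally have "L0 * ((A0 * U * A1\<^sup>T) * L1\<^sup>T) = L0 * (A0 * U)" by simp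
    also have "\<dots> = L0 * A0 * U" using assoc_mult_mat[OF L0(1) A0c U] by simp
    finally show ?thesis using L0(2) U by simp
  qed
  show ?thesis using cancel[OF T(1)] cancel[OF S(1)] eq e0 e1 by metis
qed

section \<open>Reduced echelon form by spans and by pivots\<close>

lemma vspan_mono:
  fixes S S' :: "'a::field vec set"
  assumes "S' \<subseteq> carrier_vec n" "S \<subseteq> vspan n S'"
  shows "vspan n S \<subseteq> vspan n S'"
proof -
  interpret vec_space "TYPE('a)" n .
  show ?thesis using assms span_subsetI unfolding vspan_def by blast
qed

lemma vspan_superset:
  fixes S :: "'a::field vec set"
  assumes "S \<subseteq> carrier_vec n"
  shows "S \<subseteq> vspan n S"
proof -
  interpret vec_space "TYPE('a)" n .
  show ?thesis using assms in_own_span unfolding vspan_def by blast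
qed

text \<open>The span is handled as the column space of \<open>sel_mat k i id\<close>, whose vectors
  are the explicit products.\<close>

lemma vspan_unit_vecs:
  assumes i: "i \<le> k"
  shows "vspan k (unit_vec k ` {..<i}) =
    {v \<in> carrier_vec k. \<forall>l. i \<le> l \<and> l < k \<longrightarrow> v $ l = (0 :: 'a::field)}"
proof -
  interpret vec_space "TYPE('a)" k .
  let ?J = "sel_mat k i id :: 'a mat"
  have J: "?J \<in> carrier_mat k i" by (simp add: sel_mat_def)
  have "col ?J l = unit_vec k l" if "l < i" for l
    using that i by (intro eq_vecI) (auto simp: sel_mat_def)
  then have "set (cols ?J) = unit_vec k ` {..<i}"
    using J by (auto simp: cols_def atLeast0LessThan)
  then have *: "vspan k (unit_vec k ` {..<i}) = col_space ?J"
    unfolding vspan_def col_space_def by simp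
  have entry: "(?J *\<^sub>v x) $ l = (if l < i then x $ l else 0)"
    if "x \<in> carrier_vec i" "l < k" for x l
  proof -
    have "(?J *\<^sub>v x) $ l = (\<Sum>t<i. ?J $$ (l, t) * x $ t)"
      using that J by (auto simp: scalar_prod_def atLeast0LessThan intro!: sum.cong)
    also have "\<dots> = (\<Sum>t<i. if t = l then x $ t else 0)"
      using that i by (intro sum.cong) (auto simp: sel_mat_def)
    finally show ?thesis by simp
  qed
  have "v \<in> col_space ?J" if "v \<in> carrier_vec k" "\<forall>l. i \<le> l \<and> l < k \<longrightarrow> v $ l = 0" for v
  proof -
    let ?x = "vec i (\<lambda>l. v $ l)"
    have "(?J *\<^sub>v ?x) $ l = v $ l" if "l < k" for l
      using entry[of ?x l] that \<open>\<forall>l. i \<le> l \<and> l < k \<longrightarrow> v $ l = 0\<close> by auto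
    then have "?J *\<^sub>v ?x = v" using that(1) J by (intro eq_vecI) auto
    then show ?thesis unfolding col_space_eq[OF J] using that J by auto
  qed
  moreover have "v \<in> carrier_vec k" "\<forall>l. i \<le> l \<and> l < k \<longrightarrow> v $ l = 0" if v: "v \<in> col_space ?J" for v
    using v J entry unfolding col_space_eq[OF J] by auto
  ultimately show ?thesis unfolding * by blast
qed

text \<open>By \<open>vspan_unit_vecs\<close>, the span condition at i says that the columns of A
  from i on vanish above the i-th pivot; the converse inclusion comes from the earlier pivot rows,
  which are unit rows.\<close>

lemma Ech_eq_echelons: "Ech n k = (echelons n k :: 'a::field mat set)"
proof (intro equalityI subsetI)
  fix A :: "'a mat" assume "A \<in> echelons n k"
  then obtain p where p: "echelon n k p A" by (auto simp: echelons_def)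
  note A = echelonD(1)[OF p]
  have At: "A\<^sup>T \<in> carrier_mat k n" using A by simp
  have colc: "col A\<^sup>T ` X \<subseteq> carrier_vec k" for X using A by (auto intro!: carrier_vecI)
  have unit: "col A\<^sup>T (p i) = unit_vec k i" if "i < k" for i
    using that echelonD(3,4)[OF p that] A by (intro eq_vecI) auto
  have "vspan k (col A\<^sup>T ` {..<(if i = k then n else p i)}) = vspan k (unit_vec k ` {..<i})"
    if i: "i \<le> k" for i
  proof (intro equalityI vspan_mono colc)
    show "unit_vec k ` {..<i} \<subseteq> carrier_vec k" by auto
    have "unit_vec k ` {..<i} \<subseteq> col A\<^sup>T ` {..<(if i = k then n else p i)}"
    proof
      fix v :: "'a vec" assume "v \<in> unit_vec k ` {..<i}"
      then obtain l where l: "l < i" "v = col A\<^sup>T (p l)" using unit i by auto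
      have "p l < (if i = k then n else p i)" using l i echelonD(2,3)[OF p] by auto
      then show "v \<in> col A\<^sup>T ` {..<(if i = k then n else p i)}" using l(2) by blast
    qed
    then show "unit_vec k ` {..<i} \<subseteq> vspan k (col A\<^sup>T ` {..<(if i = k then n else p i)})"
      using vspan_superset[OF colc] by blast
    show "col A\<^sup>T ` {..<(if i = k then n else p i)} \<subseteq> vspan k (unit_vec k ` {..<i})"
    proof
      fix v assume "v \<in> col A\<^sup>T ` {..<(if i = k then n else p i)}"
      then obtain j where j: "j < (if i = k then n else p i)" "v = col A\<^sup>T j" by auto
      have jn: "j < n"
      proof (cases "i = k")
        case False
        then have "j < p i" "p i < n" using j i echelonD(3)[OF p] by auto
        then show ?thesis by simp
      qed (use j in simp)
      have "A $$ (j, l) = 0" if "i \<le> l" "l < k" for l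
      proof -
        have "j < p l" using that j echelon_pivot_mono[OF p that] by (auto split: if_splits)
        then show ?thesis using echelonD(5)[OF p that(2)] by simp
      qed
      then show "v \<in> vspan k (unit_vec k ` {..<i})"
        unfolding vspan_unit_vecs[OF i] j(2) using A jn by auto
    qed
  qed
  note span = this
  have d: "dim_row A\<^sup>T = k" "dim_col A\<^sup>T = n" using A by auto
  have "RREF (A\<^sup>T)"
    unfolding RREF_def d
    by (intro exI[of _ k] exI[of _ p] conjI allI impI)
      (simp_all add: echelonD(2,3)[OF p] unit span del: col_transpose)
  then show "A \<in> Ech n k" unfolding Ech_def RCEF_def using A mrank_echelon[OF p] by simp
next
  fix A :: "'a mat" assume "A \<in> Ech n k"
  then have A: "A \<in> carrier_mat n k" and rk: "mrank A = k" and rref: "RREF (A\<^sup>T)"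
    by (auto simp: Ech_def RCEF_def)
  have d: "dim_row A\<^sup>T = k" "dim_col A\<^sup>T = n" using A by auto
  from rref obtain p0 j where p0: "p0 \<le> k" and j: "\<forall>i i'. i < i' \<and> i' < p0 \<longrightarrow> j i < j i'"
    "\<forall>i<p0. j i < n" and unit: "\<forall>i<p0. col A\<^sup>T (j i) = unit_vec k i"
    and span: "\<forall>i\<le>p0. vspan k (col A\<^sup>T ` {..<(if i = p0 then n else j i)})
      = vspan k (unit_vec k ` {..<i})"
    unfolding RREF_def d by (elim exE conjE)
  have zero: "A $$ (a, l) = 0" if "i \<le> p0" "i \<le> l" "l < k" "a < (if i = p0 then n else j i)" "a < n"
    for a l i
  proof -
    have "col A\<^sup>T ` {..<(if i = p0 then n else j i)} \<subseteq> carrier_vec k"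
      using A by (auto intro!: carrier_vecI)
    from vspan_superset[OF this] that(4)
    have "col A\<^sup>T a \<in> vspan k (unit_vec k ` {..<i})" using span that(1) by blast
    moreover have "i \<le> k" using that p0 by simp
    ultimately have "col A\<^sup>T a $ l = 0" using that vspan_unit_vecs[of i k] by blast
    then show ?thesis using that A by simp
  qed
  \<comment> \<open>The span condition for \<open>i = p0\<close> covers all rows of
    \<open>A\<close>, so its columns from \<open>p0\<close> on are zero. The rank is then at most
    \<open>p0\<close>.\<close>
  have "p0 = k"
  proof -
    let ?J = "sel_mat k p0 id :: 'a mat"
    have J: "?J \<in> carrier_mat k p0" "?J\<^sup>T \<in> carrier_mat p0 k" by (simp_all add: sel_mat_def)
    have AJ: "A * ?J \<in> carrier_mat n p0" using A J by simp
    have ent: "(A * ?J) $$ (a, l) = A $$ (a, l)" if "a < n" "l < p0" for a l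
    proof -
      have "(A * ?J) $$ (a, l) = (\<Sum>t<k. if t = l then A $$ (a, t) else 0)"
        unfolding mult_mat_entry[OF A J(1) that] using that by (intro sum.cong) (auto simp: sel_mat_def)
      then show ?thesis using that p0 by simp
    qed
    have "A = A * ?J * ?J\<^sup>T"
    proof (rule eq_matI)
      fix a l assume "a < dim_row (A * ?J * ?J\<^sup>T)" "l < dim_col (A * ?J * ?J\<^sup>T)"
      then have a: "a < n" and l: "l < k" using A J by auto
      have Jt: "?J\<^sup>T $$ (t, l) = (if t = l then 1 else 0)" if "t < p0" for t
        using that l p0 by (auto simp: sel_mat_def)
      have "(A * ?J * ?J\<^sup>T) $$ (a, l) = (\<Sum>t<p0. if t = l then A $$ (a, t) else 0)"
        unfolding mult_mat_entry[OF AJ J(2) a l]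
        using a by (intro sum.cong) (auto simp: Jt ent)
      then show "A $$ (a, l) = (A * ?J * ?J\<^sup>T) $$ (a, l)" using zero[of p0 l a] a l by auto
    qed (use A J in auto)
    then have "mrank A = mrank (A * ?J)" by (intro mrank_eq[OF A AJ J(2,1)]) auto
    then show ?thesis using mrank_le[OF AJ] rk p0 by simp
  qed
  have "echelon n k j A"
    unfolding echelon_def
  proof (intro conjI allI impI)
    show "A $$ (j i, l) = (if l = i then 1 else 0)" if "i < k" "l < k" for i l
    proof -
      have "A $$ (j i, l) = col A\<^sup>T (j i) $ l" using that j(2) A \<open>p0 = k\<close> by simp
      then show ?thesis using unit that \<open>p0 = k\<close> by simp
    qed
    show "A $$ (a, i) = 0" if "i < k" "a < j i" for i a
    proof -
      have "a < n" using that j(2) \<open>p0 = k\<close> by (meson order.strict_trans)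
      then show ?thesis using zero[of i i a] that \<open>p0 = k\<close> by simp
    qed
  qed (use A j \<open>p0 = k\<close> in auto)
  then show "A \<in> echelons n k" by (rule echelonsI)
qed

section \<open>The middle factor and the final theorem\<close>

lemma tau2_decomposition:
  assumes A0: "A0 \<in> echelons m k" and A1: "A1 \<in> echelons m k"
    and T: "T \<in> carrier_mat k k" "invertible_mat T"
  shows "tau2 (A0 * T * A1\<^sup>T) = T"
proof -
  have d: "dim_row (A0 * T * A1\<^sup>T) = m" using echelons_carrier[OF A0] by simp
  show ?thesis
    unfolding tau2_def mrank_decomposition[OF A0 A1 T] d Ech_eq_echelons
    using decomposition_unique[OF A0 A1 T] A0 A1 T by (intro the_equality) blast+
qed

lemma Mk_decomposition:
  assumes "A \<in> Mk k m m"
  shows "\<exists>A0\<in>echelons m k. \<exists>A1\<in>echelons m k. \<exists>T\<in>carrier_mat k k.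
    invertible_mat T \<and> A = A0 * T * A1\<^sup>T"
proof -
  have A: "A \<in> carrier_mat m m" "mrank A = k" using assms by (auto simp: Mk_def)
  obtain r A0 A1 T where d: "A0 \<in> echelons m r" "A1 \<in> echelons m r" "T \<in> carrier_mat r r"
    "invertible_mat T" "A = A0 * T * A1\<^sup>T" using echelon_decomposition_exists[OF A(1)] by blast
  then have "r = k" using mrank_decomposition[OF d(1-4)] A(2) by simp
  then show ?thesis using d by blast
qed

theorem theorem5p8:
  "\<forall>k m r :: nat. \<exists>n :: nat. \<forall>c :: 'a::{finite,field} mat \<Rightarrow> nat.
     (\<forall>A \<in> Mk k n n. c A < r) \<longrightarrow>
     (\<exists>R0 \<in> Ech n m. \<exists>R1 \<in> Ech n m.
        \<forall>A \<in> Mk k m m. \<forall>B \<in> Mk k m m.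
          tau2 A = tau2 B \<longrightarrow> c (R0 * A * transpose_mat R1) = c (R0 * B * transpose_mat R1))"
proof (intro allI)
  fix k m r :: nat
  \<comment> \<open>The possible values of \<open>tau2\<close> on rank k matrices; they index the
    family of colourings of pairs.\<close>
  let ?GL = "{T \<in> carrier_mat k k. invertible_mat T} :: 'a mat set"
  have "finite ?GL" using finite_carrier_mat by (rule finite_subset[rotated]) auto
  from ramsey_echelon_pairs[where ?'a = 'a, OF this, of k r m] obtain n where
    n: "\<forall>c :: 'a mat \<Rightarrow> 'a mat \<Rightarrow> 'a mat \<Rightarrow> nat.
    (\<forall>A\<in>echelons n k. \<forall>B\<in>echelons n k. \<forall>T\<in>?GL. c A B T < r) \<longrightarrow>
    (\<exists>R0\<in>echelons n m. \<exists>R1\<in>echelons n m. \<forall>A\<in>echelons m k. \<forall>A'\<in>echelons m k.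
       \<forall>B\<in>echelons m k. \<forall>B'\<in>echelons m k. \<forall>T\<in>?GL.
         c (R0 * A) (R1 * B) T = c (R0 * A') (R1 * B') T)" by (rule exE)
  show "\<exists>n. \<forall>c :: 'a mat \<Rightarrow> nat. (\<forall>A \<in> Mk k n n. c A < r) \<longrightarrow>
     (\<exists>R0 \<in> Ech n m. \<exists>R1 \<in> Ech n m. \<forall>A \<in> Mk k m m. \<forall>B \<in> Mk k m m.
          tau2 A = tau2 B \<longrightarrow> c (R0 * A * transpose_mat R1) = c (R0 * B * transpose_mat R1))"
    unfolding Ech_eq_echelons
  proof (intro exI[of _ n] allI impI)
    fix c :: "'a mat \<Rightarrow> nat" assume c: "\<forall>A \<in> Mk k n n. c A < r"
    have "c (A * T * B\<^sup>T) < r" if "A \<in> echelons n k" "B \<in> echelons n k" "T \<in> ?GL" for A B T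
    proof -
      have T: "T \<in> carrier_mat k k" "invertible_mat T" using that(3) by auto
      have "B\<^sup>T \<in> carrier_mat k n" using echelons_carrier[OF that(2)] by simp
      then have "A * T * B\<^sup>T \<in> Mk k n n"
        using mrank_decomposition[OF that(1,2) T] echelons_carrier[OF that(1)] T(1)
        by (auto simp: Mk_def intro!: mult_carrier_mat)
      then show ?thesis using c by blast
    qed
    then have "\<forall>A\<in>echelons n k. \<forall>B\<in>echelons n k. \<forall>T\<in>?GL. c (A * T * B\<^sup>T) < r" by blast
    from n[THEN spec[of _ "\<lambda>A B T. c (A * T * B\<^sup>T)"], THEN mp, OF this]
    obtain R0 R1 where R: "R0 \<in> echelons n m" "R1 \<in> echelons n m" and
      const: "\<forall>A\<in>echelons m k. \<forall>A'\<in>echelons m k. \<forall>B\<in>echelons m k. \<forall>B'\<in>echelons m k. \<forall>T\<in>?GL.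
         c (R0 * A * T * (R1 * B)\<^sup>T) = c (R0 * A' * T * (R1 * B')\<^sup>T)" by (elim bexE)
    \<comment> \<open>The restriction acts on the outer echelon factors only and leaves the middle
      factor as it is.\<close>
    have move: "R0 * (A0 * T * A1\<^sup>T) * R1\<^sup>T = R0 * A0 * T * (R1 * A1)\<^sup>T"
      if "A0 \<in> echelons m k" "A1 \<in> echelons m k" "T \<in> carrier_mat k k" for A0 A1 T
    proof -
      note Rc = echelons_carrier[OF R(1)] echelons_carrier[OF R(2)]
      note Ac = echelons_carrier[OF that(1)] echelons_carrier[OF that(2)]
      have t: "A1\<^sup>T \<in> carrier_mat k m" "R1\<^sup>T \<in> carrier_mat m n" using Ac Rc by auto
      have AT: "A0 * T \<in> carrier_mat m k" using Ac that(3) by simp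
      have RAT: "R0 * A0 * T \<in> carrier_mat n k" using Rc Ac that(3) by simp
      have "R0 * (A0 * T * A1\<^sup>T) = R0 * (A0 * T) * A1\<^sup>T"
        by (rule assoc_mult_mat[symmetric, OF Rc(1) AT t(1)])
      also have "R0 * (A0 * T) = R0 * A0 * T"
        by (rule assoc_mult_mat[symmetric, OF Rc(1) Ac(1) that(3)])
      also have "R0 * A0 * T * A1\<^sup>T * R1\<^sup>T = R0 * A0 * T * (A1\<^sup>T * R1\<^sup>T)"
        by (rule assoc_mult_mat[OF RAT t])
      finally show ?thesis using transpose_mult[OF Rc(2) Ac(2)] by simp
    qed
    have "c (R0 * A * R1\<^sup>T) = c (R0 * B * R1\<^sup>T)"
      if A: "A \<in> Mk k m m" and B: "B \<in> Mk k m m" and eq: "tau2 A = tau2 B" for A B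
    proof -
      obtain A0 A1 T where A': "A0 \<in> echelons m k" "A1 \<in> echelons m k" "T \<in> carrier_mat k k"
        "invertible_mat T" "A = A0 * T * A1\<^sup>T" using Mk_decomposition[OF A] by blast
      obtain B0 B1 S where B': "B0 \<in> echelons m k" "B1 \<in> echelons m k" "S \<in> carrier_mat k k"
        "invertible_mat S" "B = B0 * S * B1\<^sup>T" using Mk_decomposition[OF B] by blast
      have "T = S"
        using eq tau2_decomposition[OF A'(1-4)] tau2_decomposition[OF B'(1-4)] A'(5) B'(5) by simp
      moreover have "T \<in> ?GL" using A'(3,4) by simp
      ultimately show ?thesis
        unfolding A'(5) B'(5) move[OF A'(1-3)] move[OF B'(1-3)]
        using const A'(1,2) B'(1,2) by blast
    qed
    then show "\<exists>R0 \<in> echelons n m. \<exists>R1 \<in> echelons n m. \<forall>A \<in> Mk k m m. \<forall>B \<in> Mk k m m.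
          tau2 A = tau2 B \<longrightarrow> c (R0 * A * transpose_mat R1) = c (R0 * B * transpose_mat R1)"
      using R by blast
  qed
qed

end
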